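(* For every real $p>2$ there exists a constant $C_p>0$ such that the following holds. Let $W$ and $N$ be positive integers. Then either $N\le C_pW^{C_p}$ or, for any $f,g:\mathbb{Z}\to\mathbb{C}$ with $|f|\le1_{[N]}$ and $|g|\le1_{[N]}$, we have $$\int_{\mathbb{T}}\Bigl|\sum_{N/2<x\le N}f(x)e(W\alpha x^2)\sum_{N/2<y\le N}g(y)e(\alpha y)\Bigr|^p\,\mathrm{d}\alpha\ \le\ C_p\,N^{2p-2}W^{-1}.$$
   Context: $[N]=\{1,\dots,N\}$, $1_{[N]}$ is its indicator function, $\mathbb{T}=\mathbb{R}/\mathbb{Z}$ with Haar probability measure, and $e(\beta)=e^{2\pi i\beta}$. Sums are over integers. *)

theory Defs
  imports "HOL-Analysis.Analysis"
begin

definition e :: "real \<Rightarrow> complex" where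
  "e \<beta> = exp (2 * complex_of_real pi * \<i> * complex_of_real \<beta>)"

text \<open>
  Functions on the circle \<open>\<real>/\<int>\<close> are represented by 1-periodic functions on the reals. The
  Haar probability measure is the image of Lebesgue measure on the fundamental domain
  \<open>[0, 1)\<close>, so integrals against it become integrals over that interval. As for every
  Bochner integral, the value is 0 by convention when the integrand is not integrable.
\<close>

definition circle_integral :: "(real \<Rightarrow> real) \<Rightarrow> real" where
  "circle_integral F = set_lebesgue_integral lborel {0..<1} F"

end

theory Submission
  imports Defs
begin

text \<open>
  Write \<open>h (\<alpha>)\<close> for the product of the two sums. It is a single exponential sum over pairs
  \<open>(x, y)\<close> with coefficients of size at most 1 and integer frequencies \<open>W x\<^sup>2 + y\<close>. As \<open>x\<close> and \<open>y\<close>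
  both lie in \<open>(N/2, N]\<close>, these frequencies are distinct (\<open>frequencies_inj\<close>), so \<open>\<bar>h\<bar>\<^sup>2\<close> has integral
  at most \<open>N\<^sup>2\<close>. Put \<open>R = W\<^sup>1\<^sup>/\<^sup>(\<^sup>p\<^sup>-\<^sup>2\<^sup>)\<close>. Where \<open>\<bar>h\<bar> < N\<^sup>2 / R\<close>, the integral of \<open>\<bar>h\<bar>\<^sup>p\<close> is
  therefore at most \<open>(N\<^sup>2 / R)\<^sup>p\<^sup>-\<^sup>2 N\<^sup>2 = N\<^sup>2\<^sup>p\<^sup>-\<^sup>2 / W\<close>, and only the set of large values remains.

  On that set a \<open>T T\<^sup>*\<close> argument (\<open>large_values_moment_bound\<close>) removes the unknown coefficients and
  reduces the problem to the kernel \<open>K (\<theta>)\<close>, the product of the same two sums with all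
  coefficients 1. Values of \<open>K\<close> below \<open>N\<^sup>2 / (4 R\<^sup>2)\<close> can be absorbed, precisely because \<open>h\<close> is large
  there. The heart of the matter is that larger values of \<open>K\<close> occur only near \<open>\<theta> = 0\<close> on the circle,
  where \<open>\<bar>K (\<theta>)\<bar> \<le> 3 N\<^sup>2 / (1 + W N\<^sup>2 \<bar>\<theta>\<bar>)\<close> (\<open>kernel_bound\<close>). Since \<open>p / 2 > 1\<close>, the
  \<open>p/2\<close>-th power of this majorant has integral of order \<open>N\<^sup>p / (W N\<^sup>2)\<close>; multiplied by the factor
  \<open>N\<^sup>p\<close> from Cauchy--Schwarz over the \<open>N\<^sup>2\<close> pairs this is again \<open>N\<^sup>2\<^sup>p\<^sup>-\<^sup>2 / W\<close>.

  The kernel estimate is elementary. The linear sum is geometric and forces \<open>\<bar>\<theta>\<bar> \<le> 2 R\<^sup>2 / N\<close>.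
  As \<open>N\<close> is larger than a high power of \<open>W\<close>, the quadratic sum is then evaluated at a
  tiny argument \<open>W \<theta>\<close>. Down to \<open>1 / (16 N)\<close> van der Corput's inequality saves enough
  (\<open>norm_quadratic_sum_medium_frequency\<close>); below that the phase has no stationary point on
  \<open>(N/2, N]\<close>, and partial summation yields the sharp decay
  (\<open>norm_quadratic_sum_small_frequency\<close>).
\<close>

section \<open>Additive characters\<close>

lemma e_add: "e (a + b) = e a * e b"
  by (simp add: e_def ring_distribs exp_add)

lemma e_0 [simp]: "e 0 = 1"
  by (simp add: e_def)

lemma norm_e [simp]: "norm (e x) = 1"
  by (simp add: e_def norm_exp_eq_Re)

lemma cnj_e: "cnj (e x) = e (- x)"
  by (simp add: e_def exp_cnj)

lemma e_of_int [simp]: "e (of_int n) = 1"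
  using exp_integer_2pi[of "of_int n"] by (simp add: e_def mult_ac)

lemma continuous_on_e [continuous_intros]:
  "continuous_on S f \<Longrightarrow> continuous_on S (\<lambda>x. e (f x))"
  unfolding e_def by (intro continuous_intros)

lemma measurable_e [measurable]: "e \<in> borel_measurable borel"
  by (intro borel_measurable_continuous_onI continuous_intros)

lemma norm_e_minus_1: "norm (e t - 1) = 2 * \<bar>sin (pi * t)\<bar>"
  using dist_exp_i_1[of "2 * pi * t"] by (simp add: e_def mult_ac)

text \<open>
  Jordan's inequality \<open>sin x \<ge> 2 x / \<pi>\<close> on \<open>[0, \<pi>/2]\<close>, which is concavity of the sine. It
  bounds the denominators of geometric sums from below.
\<close>

lemma norm_e_minus_1_ge:
  assumes "\<bar>t\<bar> \<le> 1 / 2"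
  shows "4 * \<bar>t\<bar> \<le> norm (e t - 1)"
proof -
  have "concave_on {0..pi} sin"
    by (rule f''_le0_imp_concave[where f' = cos and f'' = "\<lambda>x. - sin x"])
       (auto intro!: derivative_eq_intros sin_ge_zero)
  then have "(1 - 2 * \<bar>t\<bar>) * sin 0 + 2 * \<bar>t\<bar> * sin (pi / 2)
      \<le> sin ((1 - 2 * \<bar>t\<bar>) *\<^sub>R 0 + (2 * \<bar>t\<bar>) *\<^sub>R (pi / 2))"
    using assms by (intro concave_onD) auto
  then have "2 * \<bar>t\<bar> \<le> sin (pi * \<bar>t\<bar>)"
    by (simp add: mult.commute)
  moreover have "\<bar>sin (pi * t)\<bar> = \<bar>sin (pi * \<bar>t\<bar>)\<bar>"
    by (cases "t \<ge> 0") auto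
  ultimately show ?thesis
    by (simp add: norm_e_minus_1)
qed

lemma norm_e_minus_1_le: "norm (e t - 1) \<le> 2 * pi * \<bar>t\<bar>"
  using abs_sin_x_le_abs_x[of "pi * t"] by (simp add: norm_e_minus_1 abs_mult)

lemma norm_geometric_sum_e_le:
  assumes "\<bar>t\<bar> \<le> 1 / 2" "t \<noteq> 0"
  shows "norm (\<Sum>i<n. e (t * real i)) \<le> 1 / (2 * \<bar>t\<bar>)"
proof -
  have pw: "e (t * real i) = e t ^ i" for i
    by (induction i) (simp_all add: ring_distribs e_add)
  have ge: "4 * \<bar>t\<bar> \<le> norm (e t - 1)"
    using assms(1) by (rule norm_e_minus_1_ge)
  then have ne: "e t \<noteq> 1"
    using assms(2) by auto
  have "norm (\<Sum>i<n. e (t * real i)) = norm (e t ^ n - 1) / norm (e t - 1)"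
    using ne by (simp add: pw geometric_sum norm_divide)
  also have "\<dots> \<le> 2 / (4 * \<bar>t\<bar>)"
    using ge assms(2) norm_triangle_ineq4[of "e t ^ n" 1]
    by (intro frac_le) (auto simp: norm_power)
  finally show ?thesis by simp
qed

section \<open>Quadratic exponential sums\<close>

text \<open>
  Partial summation: each term \<open>z i\<close> is a forward difference of \<open>z\<close> times a slowly varying factor
  \<open>r i\<close>, so the sum telescopes up to the total variation of \<open>r\<close>.
\<close>

lemma norm_sum_recurrence_le:
  fixes z r :: "nat \<Rightarrow> complex"
  assumes "\<And>i. i < n \<Longrightarrow> z i = (z (Suc i) - z i) * r i"
    and "\<And>i. norm (z i) \<le> 1"
    and "\<And>i. i \<le> n \<Longrightarrow> norm (r i) \<le> R"
    and "\<And>i. i < n \<Longrightarrow> norm (r (Suc i) - r i) \<le> \<epsilon>"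
  shows "norm (\<Sum>i<n. z i) \<le> 2 * R + real n * \<epsilon>"
proof -
  have *: "norm ((\<Sum>i<k. z i) - (z k * r k - z 0 * r 0)) \<le> real k * \<epsilon>" if "k \<le> n" for k
    using that
  proof (induction k)
    case (Suc k)
    have "z k * (1 + r k) = z (Suc k) * r k"
      using assms(1)[of k] Suc.prems by (simp add: algebra_simps)
    then have "(\<Sum>i<Suc k. z i) - (z (Suc k) * r (Suc k) - z 0 * r 0)
        = ((\<Sum>i<k. z i) - (z k * r k - z 0 * r 0)) - z (Suc k) * (r (Suc k) - r k)"
      by (simp add: algebra_simps)
    also have "norm \<dots> \<le> norm ((\<Sum>i<k. z i) - (z k * r k - z 0 * r 0))
        + norm (z (Suc k)) * norm (r (Suc k) - r k)"
      unfolding norm_mult[symmetric] by (rule norm_triangle_ineq4)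
    also have "\<dots> \<le> real k * \<epsilon> + 1 * \<epsilon>"
      using Suc assms(4)[of k] assms(2) by (intro add_mono mult_mono) auto
    finally show ?case by (simp add: ring_distribs)
  qed simp
  have zr: "norm (z i * r i) \<le> R" if "i \<le> n" for i
    using mult_mono[OF assms(2)[of i] assms(3)[OF that]] by (simp add: norm_mult)
  have "norm (\<Sum>i<n. z i)
      \<le> norm ((\<Sum>i<n. z i) - (z n * r n - z 0 * r 0)) + norm (z n * r n - z 0 * r 0)"
    by (metis add.commute norm_triangle_sub)
  also have "\<dots> \<le> real n * \<epsilon> + (R + R)"
    using *[of n] order_trans[OF norm_triangle_ineq4 add_mono[OF zr[of n] zr[of 0]]]
    by (intro add_mono) auto
  finally show ?thesis by simp
qed

text \<open>
  A bound of Kusmin--Landau type. The ratio of consecutive terms at \<open>x\<close> and \<open>x + 1\<close> is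
  \<open>e (\<beta> (2 x + 1))\<close>. Since \<open>N / 2 \<le> x \<le> N + 1\<close> and \<open>\<beta>\<close> is small, \<open>\<beta> (2 x + 1)\<close> stays
  between \<open>\<bar>\<beta>\<bar> N\<close> and \<open>1 / 2\<close> in absolute value: the phase has no stationary point, which is what
  makes the decay \<open>1 / (\<bar>\<beta>\<bar> N)\<close> possible instead of only \<open>1 / \<bar>\<beta>\<bar>\<^sup>1\<^sup>/\<^sup>2\<close>.
\<close>

lemma norm_quadratic_sum_small_frequency:
  fixes a :: int and N n :: nat
  assumes N: "N > 0" "real N / 2 \<le> real_of_int a" "a + int n \<le> int N + 1"
    and b: "\<beta> \<noteq> 0" "\<bar>\<beta>\<bar> \<le> 1 / (16 * real N)"
  shows "norm (\<Sum>i<n. e (\<beta> * (real_of_int (a + int i))\<^sup>2)) \<le> 2 / (\<bar>\<beta>\<bar> * real N)"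
proof -
  define z where "z i = e (\<beta> * (real_of_int (a + int i))\<^sup>2)" for i
  define w where "w i = e (\<beta> * (2 * real_of_int (a + int i) + 1))" for i
  define r where "r i = 1 / (w i - 1)" for i
  have zw: "z (Suc i) = w i * z i" for i
    unfolding z_def w_def e_add[symmetric]
    by (rule arg_cong[where f = e]) (simp add: power2_eq_square algebra_simps)
  have step: "w (Suc i) = w i * e (2 * \<beta>)" for i
    unfolding w_def e_add[symmetric] by (rule arg_cong[where f = e]) (simp add: algebra_simps)
  have phase: "\<bar>\<beta>\<bar> * real N \<le> \<bar>\<beta> * (2 * real_of_int (a + int i) + 1)\<bar>"
       "i \<le> n \<Longrightarrow> \<bar>\<beta> * (2 * real_of_int (a + int i) + 1)\<bar> \<le> 1 / 2" for i
  proof -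
    show "\<bar>\<beta>\<bar> * real N \<le> \<bar>\<beta> * (2 * real_of_int (a + int i) + 1)\<bar>"
      unfolding abs_mult using N by (intro mult_left_mono) auto
    assume "i \<le> n"
    then have "real_of_int (a + int i) \<le> real_of_int (int N + 1)"
      using N(3) by (intro iffD2[OF of_int_le_iff]) linarith
    then have "\<bar>\<beta> * (2 * real_of_int (a + int i) + 1)\<bar> \<le> 1 / (16 * real N) * (5 * real N)"
      unfolding abs_mult using N b by (intro mult_mono) auto
    then show "\<bar>\<beta> * (2 * real_of_int (a + int i) + 1)\<bar> \<le> 1 / 2"
      using N(1) by simp
  qed
  have pos: "\<bar>\<beta>\<bar> * real N > 0"
    using b N by simp
  have wge: "4 * (\<bar>\<beta>\<bar> * real N) \<le> norm (w i - 1)" if "i \<le> n" for i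
    using phase(1)[of i] norm_e_minus_1_ge[OF phase(2)[OF that]] unfolding w_def by linarith
  have wne: "w i \<noteq> 1" if "i \<le> n" for i
    using wge[OF that] pos by auto
  have r_le: "norm (r i) \<le> 1 / (4 * (\<bar>\<beta>\<bar> * real N))" if "i \<le> n" for i
    unfolding r_def norm_divide using wge[OF that] pos by (intro frac_le) auto
  have r_diff: "norm (r (Suc i) - r i) \<le> 1 / (\<bar>\<beta>\<bar> * (real N)\<^sup>2)" if "i < n" for i
  proof -
    have "r (Suc i) - r i = (w i - w (Suc i)) * (r i * r (Suc i))"
      using wne[of i] wne[of "Suc i"] that unfolding r_def by (simp add: field_simps)
    also have "norm \<dots> = norm (w i - w (Suc i)) * (norm (r i) * norm (r (Suc i)))"
      by (simp add: norm_mult)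
    also have "w i - w (Suc i) = w i * (1 - e (2 * \<beta>))"
      by (simp add: step algebra_simps)
    also have "norm \<dots> \<le> 2 * pi * \<bar>2 * \<beta>\<bar>"
      using norm_e_minus_1_le[of "2 * \<beta>"] by (simp add: norm_mult w_def norm_minus_commute)
    also have "\<dots> \<le> 16 * \<bar>\<beta>\<bar>"
      using pi_less_4 by (simp add: abs_mult mult_right_mono)
    also have "norm (r i) * norm (r (Suc i))
        \<le> (1 / (4 * (\<bar>\<beta>\<bar> * real N))) * (1 / (4 * (\<bar>\<beta>\<bar> * real N)))"
      using that pos by (intro mult_mono r_le) auto
    also have "16 * \<bar>\<beta>\<bar> * \<dots> = 1 / (\<bar>\<beta>\<bar> * (real N)\<^sup>2)"
      using pos by (simp add: power2_eq_square field_simps)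
    finally show ?thesis by (simp add: mult_right_mono mult_left_mono)
  qed
  have "a \<ge> 1"
    using N by linarith
  then have nN: "real n \<le> real N"
    using N(3) by linarith
  have "norm (\<Sum>i<n. z i) \<le> 2 * (1 / (4 * (\<bar>\<beta>\<bar> * real N))) + real n * (1 / (\<bar>\<beta>\<bar> * (real N)\<^sup>2))"
  proof (rule norm_sum_recurrence_le)
    show "norm (z i) \<le> 1" for i by (simp add: z_def)
    show "z i = (z (Suc i) - z i) * r i" if "i < n" for i
      using wne[of i] that by (simp add: zw r_def divide_simps) (simp add: algebra_simps)
  qed (use r_le r_diff in auto)
  also have "\<dots> \<le> 2 * (1 / (4 * (\<bar>\<beta>\<bar> * real N))) + real N * (1 / (\<bar>\<beta>\<bar> * (real N)\<^sup>2))"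
    using nN by (intro add_mono mult_right_mono) auto
  also have "\<dots> \<le> 2 / (\<bar>\<beta>\<bar> * real N)"
    using pos by (simp add: power2_eq_square field_simps)
  finally show ?thesis by (simp add: z_def)
qed

lemma norm_sum_shift_diff_le:
  fixes y :: "nat \<Rightarrow> complex"
  assumes "\<And>i. norm (y i) \<le> 1"
  shows "norm ((\<Sum>i<n. y i) - (\<Sum>i<n. y (i + m))) \<le> 2 * real m"
proof (induction m)
  case (Suc m)
  have "(\<Sum>i<n. y (i + m)) - (\<Sum>i<n. y (i + Suc m)) = y m - y (n + m)"
    using sum_lessThan_telescope'[of "\<lambda>i. y (i + m)" n] by (simp add: sum_subtractf)
  moreover have "norm (y m - y (n + m)) \<le> 1 + 1"
    by (intro order_trans[OF norm_triangle_ineq4] add_mono assms)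
  ultimately have "norm ((\<Sum>i<n. y (i + m)) - (\<Sum>i<n. y (i + Suc m))) \<le> 2"
    by simp
  then show ?case
    using norm_triangle_ineq[of "(\<Sum>i<n. y i) - (\<Sum>i<n. y (i + m))"
        "(\<Sum>i<n. y (i + m)) - (\<Sum>i<n. y (i + Suc m))"] Suc.IH by simp
qed simp

text \<open>
  Replace the sum by the average of its translates by \<open>0, d, \<dots>, (H - 1) d\<close>, which costs only
  boundary terms, and apply Cauchy--Schwarz in \<open>i\<close>. The diagonal correlations contribute \<open>n\<close> each,
  and there are only \<open>H\<close> of them among \<open>H\<^sup>2\<close>.
\<close>

lemma van_der_Corput_inequality:
  fixes y :: "nat \<Rightarrow> complex"
  assumes y: "\<And>i. norm (y i) \<le> 1" and H: "H > 0" and B: "B \<ge> 0"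
    and corr: "\<And>j k. j < H \<Longrightarrow> k < H \<Longrightarrow> j \<noteq> k \<Longrightarrow>
        norm (\<Sum>i<n. y (i + j * d) * cnj (y (i + k * d))) \<le> B"
  shows "norm (\<Sum>i<n. y i) \<le> sqrt (real n * (real n / real H + B)) + 2 * real d * real H"
proof -
  define S where "S = (\<Sum>i<n. y i)"
  define T where "T j = (\<Sum>i<n. y (i + j * d))" for j
  define v where "v i = (\<Sum>j<H. y (i + j * d))" for i
  have V: "(\<Sum>j<H. T j) = (\<Sum>i<n. v i)"
    unfolding T_def v_def by (rule sum.swap)
  have diag: "norm (\<Sum>i<n. y (i + j * d) * cnj (y (i + j * d))) \<le> real n" for j
  proof -
    have "norm (\<Sum>i<n. y (i + j * d) * cnj (y (i + j * d))) \<le> (\<Sum>i<n. 1 * 1)"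
      unfolding norm_mult complex_mod_cnj
      by (intro sum_norm_le, unfold norm_mult complex_mod_cnj, intro mult_mono y) auto
    then show ?thesis by simp
  qed
  have "(\<Sum>i<n. (norm (v i))\<^sup>2) = norm (complex_of_real (\<Sum>i<n. (norm (v i))\<^sup>2))"
    unfolding norm_of_real by (simp add: sum_nonneg)
  also have "complex_of_real (\<Sum>i<n. (norm (v i))\<^sup>2)
      = (\<Sum>i<n. \<Sum>j<H. \<Sum>k<H. y (i + j * d) * cnj (y (i + k * d)))"
    by (simp add: complex_norm_square v_def sum_product cnj_sum del: of_real_power)
  also have "\<dots> = (\<Sum>j<H. \<Sum>k<H. \<Sum>i<n. y (i + j * d) * cnj (y (i + k * d)))"
    by (rule trans[OF sum.swap sum.cong[OF refl sum.swap]])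
  also have "norm \<dots> \<le> (\<Sum>j<H. \<Sum>k<H. (if j = k then real n else 0) + B)"
    by (intro sum_norm_le) (use corr diag B in \<open>auto intro: order_trans[OF diag]\<close>)
  also have "\<dots> = real H * real n + (real H)\<^sup>2 * B"
    by (simp add: sum.distrib power2_eq_square algebra_simps)
  finally have sq: "(\<Sum>i<n. (norm (v i))\<^sup>2) \<le> real H * real n + (real H)\<^sup>2 * B" .
  have "(norm (\<Sum>i<n. v i))\<^sup>2 \<le> (\<Sum>i<n. norm (v i))\<^sup>2"
    by (intro power_mono norm_sum) auto
  also have "\<dots> \<le> real n * (\<Sum>i<n. (norm (v i))\<^sup>2)"
    using sum_squared_le_sum_of_squares[of "\<lambda>i. norm (v i)" "{..<n}"] by (simp add: mult.commute)
  also have "\<dots> \<le> real n * (real H * real n + (real H)\<^sup>2 * B)"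
    by (intro mult_left_mono sq) auto
  also have "\<dots> = (real H)\<^sup>2 * (real n * (real n / real H + B))"
    using H by (simp add: power2_eq_square field_simps)
  finally have "norm (\<Sum>i<n. v i) \<le> sqrt ((real H)\<^sup>2 * (real n * (real n / real H + B)))"
    by (rule real_le_rsqrt)
  then have bound_V: "norm (\<Sum>j<H. T j) \<le> real H * sqrt (real n * (real n / real H + B))"
    by (simp add: V real_sqrt_mult)
  have "norm (\<Sum>j<H. S - T j) \<le> (\<Sum>j<H. 2 * real d * real H)"
  proof (intro sum_norm_le)
    fix j assume "j \<in> {..<H}"
    have "norm (S - T j) \<le> 2 * real (j * d)"
      unfolding S_def T_def by (rule norm_sum_shift_diff_le[OF y])
    also have "\<dots> \<le> 2 * real d * real H"
      using \<open>j \<in> {..<H}\<close> by (auto simp: mult.commute[of "real j"] mult_left_mono)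
    finally show "norm (S - T j) \<le> 2 * real d * real H" .
  qed
  moreover have "(\<Sum>j<H. S - T j) + (\<Sum>j<H. T j) = of_nat H * S"
    by (simp add: sum_subtractf)
  ultimately have "real H * norm S
      \<le> real H * (2 * real d * real H) + real H * sqrt (real n * (real n / real H + B))"
    using norm_triangle_ineq[of "\<Sum>j<H. S - T j" "\<Sum>j<H. T j"] bound_V
    by (simp add: norm_mult)
  then have "real H * norm S
      \<le> real H * (sqrt (real n * (real n / real H + B)) + 2 * real d * real H)"
    by (simp add: algebra_simps)
  then show ?thesis
    using H by (simp add: S_def)
qed

text \<open>
  The correlations of \<open>e (\<beta> x\<^sup>2)\<close> are geometric sums. Spacing the \<open>H\<close> translates by \<open>H\<close> makes every
  off-diagonal phase step at least \<open>2 \<bar>\<beta>\<bar> H\<close>, while the condition on \<open>\<bar>\<beta>\<bar> H\<^sup>2\<close> prevents it from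
  wrapping around the circle; so each off-diagonal correlation saves a factor of order \<open>H\<close>, the
  same saving as the diagonal yields by being sparse.
\<close>

lemma norm_quadratic_sum_medium_frequency:
  fixes a :: int and N n H :: nat
  assumes n: "n \<le> N" and H: "H > 0"
    and b: "1 / (16 * real N) \<le> \<bar>\<beta>\<bar>" "2 * \<bar>\<beta>\<bar> * (real H)\<^sup>2 \<le> 1 / 2" and N: "N > 0"
  shows "norm (\<Sum>i<n. e (\<beta> * (real_of_int (a + int i))\<^sup>2))
      \<le> 3 * real N / sqrt (real H) + 2 * (real H)\<^sup>2"
proof -
  define y where "y i = e (\<beta> * (real_of_int (a + int i))\<^sup>2)" for i
  have bpos: "\<bar>\<beta>\<bar> > 0"
    using b(1) N by (smt (verit) divide_pos_pos of_nat_0_less_iff)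
  have corr: "norm (\<Sum>i<n. y (i + j * H) * cnj (y (i + k * H))) \<le> 4 * real N / real H"
    if jk: "j < H" "k < H" "j \<noteq> k" for j k
  proof -
    \<comment> \<open>The quadratic terms in \<open>i\<close> cancel; \<open>t\<close> is the slope and \<open>c\<close> the constant part of the phase.\<close>
    define t where "t = 2 * \<beta> * real H * (real j - real k)"
    define c where "c = \<beta> * (2 * real_of_int a * real H * (real j - real k)
        + (real H)\<^sup>2 * ((real j)\<^sup>2 - (real k)\<^sup>2))"
    have "y (i + j * H) * cnj (y (i + k * H)) = e c * e (t * real i)" for i
      unfolding y_def cnj_e e_add[symmetric]
      by (rule arg_cong[where f = e]) (simp add: t_def c_def power2_eq_square algebra_simps)
    then have "norm (\<Sum>i<n. y (i + j * H) * cnj (y (i + k * H))) = norm (\<Sum>i<n. e (t * real i))"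
      by (simp add: sum_distrib_left[symmetric] norm_mult)
    also have "\<dots> \<le> 1 / (2 * \<bar>t\<bar>)"
    proof (rule norm_geometric_sum_e_le)
      have "\<bar>t\<bar> \<le> 2 * \<bar>\<beta>\<bar> * real H * real H"
        unfolding t_def abs_mult using jk by (intro mult_mono) auto
      then show "\<bar>t\<bar> \<le> 1 / 2"
        using b(2) by (simp add: power2_eq_square mult_ac)
      show "t \<noteq> 0" using jk H bpos by (simp add: t_def)
    qed
    also have "\<dots> \<le> 4 * real N / real H"
    proof -
      have "2 * (1 / (16 * real N)) * real H * 1 \<le> \<bar>t\<bar>"
        unfolding t_def abs_mult using jk b(1) by (intro mult_mono) auto
      then have "real H / (4 * real N) \<le> 2 * \<bar>t\<bar>"
        by simp
      then have "1 / (2 * \<bar>t\<bar>) \<le> 1 / (real H / (4 * real N))"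
        using H N by (intro frac_le) auto
      then show ?thesis by simp
    qed
    finally show ?thesis .
  qed
  have "norm (\<Sum>i<n. y i)
      \<le> sqrt (real n * (real n / real H + 4 * real N / real H)) + 2 * real H * real H"
    by (rule van_der_Corput_inequality) (use H corr in \<open>auto simp: y_def\<close>)
  also have "real n * (real n / real H + 4 * real N / real H) \<le> real N * (real N / real H + 4 * real N / real H)"
    using n H by (intro mult_mono add_mono divide_right_mono) auto
  also have "\<dots> \<le> (3 * real N)\<^sup>2 / real H"
    using H by (simp add: power2_eq_square field_simps)
  also have "sqrt \<dots> = 3 * real N / sqrt (real H)"
    unfolding real_sqrt_divide real_sqrt_abs by simp
  finally show ?thesis
    by (simp add: y_def power2_eq_square)
qed

section \<open>The kernel and the frequencies\<close>

text \<open>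
  Three ranges of \<open>t\<close>. If \<open>\<bar>t\<bar> \<ge> 2 R\<^sup>2 / N\<close>, the linear sum is a geometric sum of size at most
  \<open>N / (4 R\<^sup>2)\<close>. If \<open>\<bar>t\<bar>\<close> is smaller but \<open>W \<bar>t\<bar> \<ge> 1 / (16 N)\<close>, then \<open>W t\<close> is at most
  \<open>1 / (4 H\<^sup>2)\<close> in absolute value by the lower bound assumed for \<open>N\<close>, and van der Corput's
  inequality makes the quadratic sum at most \<open>N / (4 R\<^sup>2)\<close>. Thus the localisation of \<open>t\<close> by the linear
  sum leaves \<open>0\<close> as the only rational near which the quadratic sum can be large. For the remaining \<open>t\<close> the quadratic sum decays like \<open>1 / (W \<bar>t\<bar> N)\<close>.
\<close>

lemma kernel_bound_centred:
  fixes a :: int and N n W H :: nat and R t :: real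
  assumes N: "N > 0" "real N / 2 \<le> real_of_int a" "a + int n \<le> int N + 1"
    and W: "W > 0" and R: "R \<ge> 1"
    and H: "576 * R ^ 4 \<le> real H" "16 * (real H)\<^sup>2 * R\<^sup>2 * real W \<le> real N"
    and t: "\<bar>t\<bar> \<le> 1 / 2"
  defines "k \<equiv> norm (\<Sum>i<n. e (real W * t * (real_of_int (a + int i))\<^sup>2))
                * norm (\<Sum>i<n. e (t * real_of_int (a + int i)))"
  shows "k \<le> (real N)\<^sup>2 / (4 * R\<^sup>2) \<or> k \<le> 3 * (real N)\<^sup>2 / (1 + real W * (real N)\<^sup>2 * \<bar>t\<bar>)"
proof -
  define S where "S = norm (\<Sum>i<n. e (real W * t * (real_of_int (a + int i))\<^sup>2))"
  define D where "D = norm (\<Sum>i<n. e (t * real_of_int (a + int i)))"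
  have k: "k = S * D" by (simp add: k_def S_def D_def)
  have "a \<ge> 1" using N by linarith
  then have nN: "n \<le> N" using N(3) by linarith
  have triv: "norm (\<Sum>i<n. e (u i)) \<le> real N" for u
    using nN by (intro order_trans[OF sum_norm_le[where g = "\<lambda>_. 1"]]) auto
  have S_le: "S \<le> real N" and D_le: "D \<le> real N"
    unfolding S_def D_def by (rule triv)+
  have nonneg: "S \<ge> 0" "D \<ge> 0"
    by (simp_all add: S_def D_def)
  have R2: "R\<^sup>2 > 0" "R \<noteq> 0" using R by auto
  consider "t = 0" | "2 * R\<^sup>2 / real N \<le> \<bar>t\<bar>"
    | "t \<noteq> 0" "real W * \<bar>t\<bar> \<le> 1 / (16 * real N)"
    | "1 / (16 * real N) \<le> real W * \<bar>t\<bar>" "\<bar>t\<bar> \<le> 2 * R\<^sup>2 / real N"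
    by linarith
  then show ?thesis
  proof cases
    case 1
    have "k \<le> real N * real N"
      unfolding k using S_le D_le nonneg by (intro mult_mono) auto
    also have "\<dots> \<le> 3 * (real N * real N)" by simp
    finally show ?thesis using 1 by (simp add: power2_eq_square)
  next
    case 2
    have tpos: "0 < 2 * R\<^sup>2 / real N" using R2 N by simp
    have "D = norm (\<Sum>i<n. e (t * real i))"
      by (simp add: D_def ring_distribs e_add sum_distrib_left[symmetric] norm_mult)
    also have "\<dots> \<le> 1 / (2 * \<bar>t\<bar>)"
      using 2 tpos by (intro norm_geometric_sum_e_le t) auto
    also have "\<dots> \<le> 1 / (2 * (2 * R\<^sup>2 / real N))"
      using 2 tpos by (intro frac_le) auto
    finally have "D \<le> real N / (4 * R\<^sup>2)" by simp
    then have "k \<le> real N * (real N / (4 * R\<^sup>2))"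
      unfolding k using S_le nonneg by (intro mult_mono) auto
    then show ?thesis by (simp add: power2_eq_square)
  next
    case 3
    define y where "y = real W * (real N)\<^sup>2 * \<bar>t\<bar>"
    have y: "y > 0" using 3 W N by (simp add: y_def)
    have "S \<le> 2 / (\<bar>real W * t\<bar> * real N)"
      unfolding S_def using 3 W by (intro norm_quadratic_sum_small_frequency N) (auto simp: abs_mult)
    also have "\<dots> = real N * (2 / y)"
      using N by (simp add: y_def abs_mult power2_eq_square)
    finally have "S \<le> real N * (2 / y)" .
    moreover have "min 1 (2 / y) \<le> 3 / (1 + y)"
      using y by (cases "y \<le> 2") (auto simp: min_def divide_simps)
    ultimately have "S \<le> real N * (3 / (1 + y))"
      using S_le by (smt (verit) mult_left_mono mult_cancel_left1 of_nat_0_le_iff)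
    then have "k \<le> real N * (3 / (1 + y)) * real N"
      unfolding k using D_le nonneg by (intro mult_mono) auto
    then show ?thesis by (simp add: y_def power2_eq_square mult_ac)
  next
    case 4
    have H0: "H > 0"
      using H(1) R2 by (cases "H = 0") auto
    have W1: "1 \<le> real W" using W by simp
    \<comment> \<open>With this size of \<open>H\<close> each of the two terms below is at most \<open>N / (8 R\<^sup>2)\<close>.\<close>
    have "(24 * R\<^sup>2)\<^sup>2 \<le> real H"
      using H(1) by (simp add: power_mult_distrib)
    then have sqrtH: "24 * R\<^sup>2 \<le> sqrt (real H)"
      by (rule real_le_rsqrt)
    have "S \<le> 3 * real N / sqrt (real H) + 2 * (real H)\<^sup>2"
      unfolding S_def
    proof (rule norm_quadratic_sum_medium_frequency[OF nN H0 _ _ N(1)])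
      show "1 / (16 * real N) \<le> \<bar>real W * t\<bar>" using 4 by (simp add: abs_mult)
      have "2 * \<bar>real W * t\<bar> * (real H)\<^sup>2 \<le> 2 * (real W * (2 * R\<^sup>2 / real N)) * (real H)\<^sup>2"
        unfolding abs_mult abs_of_nat using 4(2) by (intro mult_right_mono mult_left_mono) simp_all
      also have "\<dots> = (16 * (real H)\<^sup>2 * R\<^sup>2 * real W) / (4 * real N)"
        by simp
      also have "\<dots> \<le> real N / (4 * real N)"
        by (intro divide_right_mono H) auto
      finally show "2 * \<bar>real W * t\<bar> * (real H)\<^sup>2 \<le> 1 / 2"
        using N by simp
    qed
    also have "3 * real N / sqrt (real H) \<le> 3 * real N / (24 * R\<^sup>2)"
      using sqrtH R2 by (intro divide_left_mono) (auto intro!: mult_pos_pos simp: H0)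
    also have "2 * (real H)\<^sup>2 \<le> real N / (8 * R\<^sup>2)"
    proof -
      have "16 * (real H)\<^sup>2 * R\<^sup>2 * 1 \<le> 16 * (real H)\<^sup>2 * R\<^sup>2 * real W"
        using W1 by (intro mult_left_mono) auto
      with H(2) have "16 * (real H)\<^sup>2 * R\<^sup>2 \<le> real N"
        by linarith
      then show ?thesis using R2 by (simp add: field_simps)
    qed
    finally have "S \<le> real N / (4 * R\<^sup>2)" by (simp add: field_simps)
    then have "k \<le> real N / (4 * R\<^sup>2) * real N"
      unfolding k using D_le nonneg by (intro mult_mono) auto
    then show ?thesis by (simp add: power2_eq_square)
  qed
qed

text \<open>
  The product is 1-periodic in \<open>\<theta>\<close>, as all frequencies are integers; the shift by \<open>s\<close> moves a
  difference of two points of \<open>[0, 1)\<close> into \<open>[-1/2, 1/2]\<close>.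
\<close>

lemma kernel_bound:
  fixes a :: int and N n W H :: nat and R \<theta> :: real
  assumes "N > 0" "real N / 2 \<le> real_of_int a" "a + int n \<le> int N + 1"
    and "W > 0" and "R \<ge> 1"
    and "576 * R ^ 4 \<le> real H" "16 * (real H)\<^sup>2 * R\<^sup>2 * real W \<le> real N"
    and \<theta>: "\<bar>\<theta>\<bar> < 1"
  defines "k \<equiv> norm (\<Sum>i<n. e (real W * \<theta> * (real_of_int (a + int i))\<^sup>2))
                * norm (\<Sum>i<n. e (\<theta> * real_of_int (a + int i)))"
  shows "k \<le> (real N)\<^sup>2 / (4 * R\<^sup>2) \<or>
    (\<exists>s\<in>{-1, 0, 1}. k \<le> 3 * (real N)\<^sup>2 / (1 + real W * (real N)\<^sup>2 * \<bar>\<theta> + s\<bar>))"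
proof -
  define s :: int where "s = (if \<theta> > 1 / 2 then -1 else if \<theta> < - 1 / 2 then 1 else 0)"
  have t: "\<bar>\<theta> + real_of_int s\<bar> \<le> 1 / 2"
    using \<theta> by (auto simp: s_def)
  have "e (real W * (\<theta> + real_of_int s) * (real_of_int x)\<^sup>2) = e (real W * \<theta> * (real_of_int x)\<^sup>2)" for x
    using e_add[of "real W * \<theta> * (real_of_int x)\<^sup>2" "real_of_int (int W * s * x\<^sup>2)"]
    unfolding e_of_int by (simp add: algebra_simps)
  moreover have "e ((\<theta> + real_of_int s) * real_of_int x) = e (\<theta> * real_of_int x)" for x
    using e_add[of "\<theta> * real_of_int x" "real_of_int (s * x)"]
    unfolding e_of_int by (simp add: algebra_simps)
  ultimately have "k = norm (\<Sum>i<n. e (real W * (\<theta> + real_of_int s) * (real_of_int (a + int i))\<^sup>2))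
                * norm (\<Sum>i<n. e ((\<theta> + real_of_int s) * real_of_int (a + int i)))"
    unfolding k_def by presburger
  then have "k \<le> (real N)\<^sup>2 / (4 * R\<^sup>2) \<or>
      k \<le> 3 * (real N)\<^sup>2 / (1 + real W * (real N)\<^sup>2 * \<bar>\<theta> + real_of_int s\<bar>)"
    using kernel_bound_centred[OF assms(1-7) t] by simp
  moreover have "real_of_int s \<in> {-1, 0, 1}"
    by (simp add: s_def)
  ultimately show ?thesis by blast
qed

text \<open>
  Distinct values of \<open>W x\<^sup>2\<close> differ by at least \<open>2 x\<close> for the smaller \<open>x\<close>, and two values of \<open>y\<close>
  differ by less than that. This is where it matters that \<open>x\<close> stays away from \<open>0\<close>.
\<close>

lemma frequencies_inj:
  fixes a :: int and n W :: nat
  assumes "W > 0" "int n \<le> 2 * a"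
  shows "inj_on (\<lambda>(i, k). int W * (a + int i)\<^sup>2 + (a + int k)) ({..<n} \<times> {..<n})"
proof -
  have less: False if "i < i'" "k < n" "k' < n"
      "int W * (a + int i)\<^sup>2 + (a + int k) = int W * (a + int i')\<^sup>2 + (a + int k')" for i i' k k'
  proof -
    have "int W * ((a + int i')\<^sup>2 - (a + int i)\<^sup>2) = int k - int k'"
      using that(4) by (simp add: algebra_simps)
    also have "(a + int i')\<^sup>2 - (a + int i)\<^sup>2 = (int i' - int i) * (2 * a + int i + int i')"
      by (simp add: power2_eq_square algebra_simps)
    finally have eq: "int W * ((int i' - int i) * (2 * a + int i + int i')) = int k - int k'" .
    have "1 * (1 * (2 * a)) \<le> int W * ((int i' - int i) * (2 * a + int i + int i'))"
      using assms that(1) by (intro mult_mono mult_nonneg_nonneg) auto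
    then show False using eq that assms by linarith
  qed
  show ?thesis
  proof (rule inj_onI, clarsimp)
    fix i k i' k'
    assume *: "i < n" "k < n" "i' < n" "k' < n"
      "int W * (a + int i)\<^sup>2 + int k = int W * (a + int i')\<^sup>2 + int k'"
    then have "i = i'"
      using less[of i i' k k'] less[of i' i k' k] by (metis add.left_commute linorder_neqE_nat)
    then show "i = i' \<and> k = k'" using * by simp
  qed
qed

section \<open>Moments over sets of large values\<close>

lemma measurable_cnj [measurable]: "cnj \<in> borel_measurable borel"
  by (intro borel_measurable_continuous_onI continuous_intros)

text \<open>
  In the second alternative with \<open>m > u v / 4\<close>, trade a power \<open>(u v)\<^sup>p\<^sup>/\<^sup>2\<^sup>-\<^sup>1\<close> for
  \<open>(4 m)\<^sup>p\<^sup>/\<^sup>2\<^sup>-\<^sup>1\<close>, which needs \<open>p > 2\<close>, and split the remaining \<open>(u v)\<^sup>p\<^sup>/\<^sup>2\<close> by the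
  arithmetic-geometric mean inequality; the constant is \<open>2\<^sup>p / 8 = 4\<^sup>p\<^sup>/\<^sup>2\<^sup>-\<^sup>1 / 2\<close>.
  This plays the role of Young's convolution inequality with exponent \<open>p / 2\<close> for the kernel.
\<close>

lemma powr_large_values_dichotomy:
  fixes u v m k p :: real
  assumes "p > 2" "u \<ge> 0" "v \<ge> 0" "m \<ge> 0" "k \<ge> 0"
    and "m \<le> u * v / 4 \<or> m powr (p / 2) \<le> k"
  shows "(u powr (p - 1) * v powr (p - 1)) * m
      \<le> u powr p * v powr p / 4 + 2 powr p / 8 * (k * (u powr p + v powr p))"
proof (cases "m \<le> u * v / 4")
  case True
  have pw: "x powr (p - 1) * x = x powr p" if "x \<ge> 0" for x :: real
    using that assms(1) powr_add[of x "p - 1" 1] by simp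
  have "(u powr (p - 1) * v powr (p - 1)) * m \<le> (u powr (p - 1) * v powr (p - 1)) * (u * v / 4)"
    using True by (intro mult_left_mono) auto
  also have "\<dots> = (u powr (p - 1) * u) * (v powr (p - 1) * v) / 4"
    by simp
  also have "\<dots> = u powr p * v powr p / 4"
    using assms by (simp only: pw)
  finally show ?thesis
    using assms by (smt (verit) mult_nonneg_nonneg powr_ge_zero divide_nonneg_nonneg)
next
  case False
  define s where "s = u * v"
  have s: "0 \<le> s" "s \<le> 4 * m" and m: "m > 0"
    using False mult_nonneg_nonneg[OF assms(2,3)] by (auto simp: s_def)
  have "u powr (p - 1) * v powr (p - 1) = s powr (p / 2) * s powr (p / 2 - 1)"
    unfolding powr_add[symmetric] s_def using assms by (simp add: powr_mult)
  also have "s powr (p / 2) \<le> (u powr p + v powr p) / 2"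
  proof -
    have "u powr p = (u powr (p / 2))\<^sup>2" "v powr p = (v powr (p / 2))\<^sup>2"
      by (simp_all add: power2_eq_square powr_add[symmetric])
    moreover have "s powr (p / 2) = u powr (p / 2) * v powr (p / 2)"
      using assms by (simp add: s_def powr_mult)
    ultimately show ?thesis
      using sum_squares_bound[of "u powr (p / 2)" "v powr (p / 2)"] by simp
  qed
  also have "s powr (p / 2 - 1) \<le> (4 * m) powr (p / 2 - 1)"
    using s assms by (intro powr_mono2) auto
  finally have "(u powr (p - 1) * v powr (p - 1)) * m
      \<le> ((u powr p + v powr p) / 2 * (4 * m) powr (p / 2 - 1)) * m"
    using m by (simp add: mult_left_mono mult_right_mono)
  also have "(4 * m) powr (p / 2 - 1) = 2 powr p / 4 * m powr (p / 2 - 1)"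
  proof -
    have "(4::real) powr (p / 2) = (2 powr 2) powr (p / 2)"
      by simp
    also have "\<dots> = 2 powr p"
      by (simp only: powr_powr) simp
    finally show ?thesis
      using m by (simp add: powr_mult powr_diff)
  qed
  also have "(u powr p + v powr p) / 2 * (2 powr p / 4 * m powr (p / 2 - 1)) * m
      = 2 powr p / 8 * (m powr (p / 2 - 1) * m) * (u powr p + v powr p)"
    by (simp add: algebra_simps)
  also have "m powr (p / 2 - 1) * m = m powr (p / 2)"
    using m by (simp add: powr_diff)
  also have "2 powr p / 8 * m powr (p / 2) * (u powr p + v powr p)
      \<le> 2 powr p / 8 * k * (u powr p + v powr p)"
    using False assms by (intro mult_right_mono mult_left_mono add_nonneg_nonneg) auto
  finally show ?thesis
    using mult_nonneg_nonneg[OF powr_ge_zero powr_ge_zero, of u p v p]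
    unfolding mult.assoc by linarith
qed

text \<open>
  The \<open>T T\<^sup>*\<close> argument restricted to a set \<open>A\<close> of large values. Write the moment \<open>I\<close> as the
  integral of \<open>h\<close> against \<open>\<phi> = \<bar>h\<bar>\<^sup>p\<^sup>-\<^sup>2 cnj h\<close> on \<open>A\<close>, expand \<open>h\<close>, and apply Cauchy--Schwarz over
  \<open>J\<close>; the coefficients \<open>c\<close> disappear and \<open>I\<^sup>2\<close> is bounded by \<open>card J\<close> times the double integral
  of \<open>\<phi> (a) cnj (\<phi> (b)) K (a, b)\<close>. Where the kernel is small relative to \<open>\<bar>h (a) h (b)\<bar>\<close>, it
  contributes at most \<open>I\<^sup>2 / 4\<close>, which is absorbed on the left; elsewhere the \<open>p/2\<close>-th power of \<open>card J \<bar>K\<bar>\<close>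
  is dominated by \<open>\<kappa>\<close>, whose marginal integrals are at most \<open>Q\<close>. Dividing by \<open>I\<close> gives the bound.
\<close>

lemma large_values_moment_bound:
  fixes M :: "'a measure" and \<psi> :: "'i \<Rightarrow> 'a \<Rightarrow> complex" and c :: "'i \<Rightarrow> complex"
    and h :: "'a \<Rightarrow> complex" and K :: "'a \<Rightarrow> 'a \<Rightarrow> complex" and \<kappa> :: "'a \<Rightarrow> 'a \<Rightarrow> real"
  assumes M: "finite_measure M" and J: "finite J" and p: "p > 2"
    and \<psi>_meas [measurable]: "\<And>j. \<psi> j \<in> borel_measurable M"
    and \<psi>_le: "\<And>j a. norm (\<psi> j a) \<le> 1" and c_le: "\<And>j. norm (c j) \<le> 1"
    and h: "\<And>a. h a = (\<Sum>j\<in>J. c j * \<psi> j a)"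
    and K: "\<And>a b. K a b = (\<Sum>j\<in>J. \<psi> j a * cnj (\<psi> j b))"
    and A [measurable]: "A \<in> sets M"
    and \<kappa>_meas [measurable]: "(\<lambda>(a, b). \<kappa> a b) \<in> borel_measurable (M \<Otimes>\<^sub>M M)"
    and \<kappa>_bounds: "\<And>a b. 0 \<le> \<kappa> a b" "\<And>a b. \<kappa> a b \<le> B"
    and \<kappa>_integral: "\<And>a. (\<integral>b. \<kappa> a b \<partial>M) \<le> Q" "\<And>b. (\<integral>a. \<kappa> a b \<partial>M) \<le> Q" and Q: "Q \<ge> 0"
    and dichotomy: "\<And>a b. a \<in> A \<Longrightarrow> b \<in> A \<Longrightarrow>
        real (card J) * norm (K a b) \<le> norm (h a) * norm (h b) / 4 \<or>
        (real (card J) * norm (K a b)) powr (p / 2) \<le> \<kappa> a b"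
  shows "(\<integral>a. indicator A a * norm (h a) powr p \<partial>M) \<le> 2 powr p * Q"
proof -
  interpret finite_measure M by (rule M)
  interpret MM: pair_sigma_finite M M ..
  interpret P: finite_measure "M \<Otimes>\<^sub>M M"
    by (rule finite_measure_pair_measure) (rule M)+
  define L where "L = real (card J)"
  define U where "U a = indicator A a * norm (h a) powr p" for a
  define \<phi> where "\<phi> a = indicator A a * of_real (norm (h a) powr (p - 2)) * cnj (h a)" for a
  define I where "I = (\<integral>a. U a \<partial>M)"
  define v where "v j = (\<integral>a. \<phi> a * \<psi> j a \<partial>M)" for j
  define F where "F a b = \<phi> a * cnj (\<phi> b) * K a b" for a b
  have h_meas [measurable]: "h \<in> borel_measurable M"
    unfolding h[abs_def] by measurable
  have K_meas [measurable]: "(\<lambda>(a, b). K a b) \<in> borel_measurable (M \<Otimes>\<^sub>M M)"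
    unfolding K by measurable
  have U_meas [measurable]: "U \<in> borel_measurable M"
    unfolding U_def[abs_def] by measurable
  have \<phi>_meas [measurable]: "\<phi> \<in> borel_measurable M"
    unfolding \<phi>_def[abs_def] by measurable
  have F_meas [measurable]: "(\<lambda>(a, b). F a b) \<in> borel_measurable (M \<Otimes>\<^sub>M M)"
    unfolding F_def by measurable
  have h_le: "norm (h a) \<le> L" for a
  proof -
    have "norm (h a) \<le> (\<Sum>j\<in>J. 1 * 1)"
      unfolding h by (intro sum_norm_le, unfold norm_mult, intro mult_mono c_le \<psi>_le) auto
    then show ?thesis by (simp add: L_def)
  qed
  have K_le: "norm (K a b) \<le> L" for a b
  proof -
    have "norm (K a b) \<le> (\<Sum>j\<in>J. 1 * 1)"
      unfolding K by (intro sum_norm_le, unfold norm_mult complex_mod_cnj, intro mult_mono \<psi>_le) auto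
    then show ?thesis by (simp add: L_def)
  qed
  have L0: "L \<ge> 0" by (simp add: L_def)
  have norm_\<phi>: "norm (\<phi> a) = indicator A a * norm (h a) powr (p - 1)" for a
    using p powr_add[of "norm (h a)" "p - 2" 1]
    by (simp add: \<phi>_def norm_mult indicator_def)
  have \<phi>_h: "\<phi> a * h a = of_real (U a)" for a
  proof -
    have "norm (h a) powr p = norm (h a) powr (p - 2) * (norm (h a))\<^sup>2"
      using p powr_add[of "norm (h a)" "p - 2" 2] by (cases "h a = 0") (auto simp: powr_numeral)
    then show ?thesis
      by (simp add: \<phi>_def U_def indicator_def mult_ac complex_norm_square[symmetric])
  qed
  have U0: "U a \<ge> 0" for a by (simp add: U_def)
  have U_le: "U a \<le> L powr p" for a
    using p h_le[of a] by (auto simp: U_def indicator_def intro!: powr_mono2)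
  have \<phi>_le: "norm (\<phi> a) \<le> L powr (p - 1)" for a
    unfolding norm_\<phi> using p h_le[of a] by (auto simp: indicator_def intro!: powr_mono2)
  have U_int [simp]: "integrable M U"
    using U_le U0 by (intro integrable_const_bound[of _ "L powr p"]) auto
  have \<phi>\<psi>_int [simp]: "integrable M (\<lambda>a. \<phi> a * \<psi> j a)" for j
  proof (intro integrable_const_bound[of _ "L powr (p - 1) * 1"] AE_I2)
    fix a show "norm (\<phi> a * \<psi> j a) \<le> L powr (p - 1) * 1"
      unfolding norm_mult by (intro mult_mono \<phi>_le \<psi>_le) auto
  qed auto
  have F_int: "integrable (M \<Otimes>\<^sub>M M) (\<lambda>(a, b). F a b)"
  proof (intro P.integrable_const_bound[of _ "L powr (p - 1) * L powr (p - 1) * L"] AE_I2)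
    fix x show "norm (case x of (a, b) \<Rightarrow> F a b) \<le> L powr (p - 1) * L powr (p - 1) * L"
      using L0 by (cases x) (auto simp: F_def norm_mult intro!: mult_mono \<phi>_le K_le)
  qed auto
  have B: "B \<ge> 0"
    using order_trans[OF \<kappa>_bounds(1) \<kappa>_bounds(2)] .
  have UU_int: "integrable (M \<Otimes>\<^sub>M M) (\<lambda>(a, b). U a * U b)"
    using U_le U0
    by (intro P.integrable_const_bound[of _ "L powr p * L powr p"] AE_I2)
       (auto simp: abs_mult intro!: mult_mono)
  have \<kappa>U_int: "integrable (M \<Otimes>\<^sub>M M) (\<lambda>(a, b). \<kappa> a b * U a)"
      "integrable (M \<Otimes>\<^sub>M M) (\<lambda>(a, b). \<kappa> a b * U b)"
    using U_le U0 \<kappa>_bounds B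
    by (intro P.integrable_const_bound[of _ "B * L powr p"] AE_I2,
        auto simp: abs_mult intro!: mult_mono)+
  have I0: "I \<ge> 0"
    unfolding I_def by (intro integral_nonneg_AE) (auto simp: U0)
  have "complex_of_real I = (\<integral>a. \<phi> a * h a \<partial>M)"
    unfolding \<phi>_h I_def by (rule integral_complex_of_real[symmetric])
  also have "\<dots> = (\<integral>a. (\<Sum>j\<in>J. c j * (\<phi> a * \<psi> j a)) \<partial>M)"
    by (simp add: h sum_distrib_left mult_ac)
  also have "\<dots> = (\<Sum>j\<in>J. c j * v j)"
    unfolding v_def by (subst Bochner_Integration.integral_sum) auto
  finally have "I = norm (\<Sum>j\<in>J. c j * v j)"
    using I0 by (metis abs_of_nonneg norm_of_real)
  also have "\<dots> \<le> (\<Sum>j\<in>J. norm (v j))"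
    using c_le by (intro sum_norm_le) (simp add: norm_mult mult_left_le_one_le)
  finally have "I\<^sup>2 \<le> (\<Sum>j\<in>J. norm (v j))\<^sup>2"
    using I0 by (rule power_mono)
  also have "\<dots> \<le> L * (\<Sum>j\<in>J. (norm (v j))\<^sup>2)"
    using sum_squared_le_sum_of_squares[of "\<lambda>j. norm (v j)" J] J by (simp add: L_def mult.commute)
  also have "(\<Sum>j\<in>J. (norm (v j))\<^sup>2) = norm (complex_of_real (\<Sum>j\<in>J. (norm (v j))\<^sup>2))"
    unfolding norm_of_real by (simp add: sum_nonneg)
  also have "complex_of_real (\<Sum>j\<in>J. (norm (v j))\<^sup>2) = (\<Sum>j\<in>J. v j * cnj (v j))"
    by (simp add: complex_norm_square del: of_real_power)
  also have "\<dots> = (\<integral>a. (\<integral>b. F a b \<partial>M) \<partial>M)"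
  proof -
    have "has_bochner_integral M (\<lambda>b. cnj (\<phi> b) * cnj (\<psi> j b)) (cnj (v j))" for j
      using has_bochner_integral_cnj[OF has_bochner_integral_integrable[OF \<phi>\<psi>_int[of j]]]
      by (simp add: v_def)
    then have cv: "cnj (v j) = (\<integral>b. cnj (\<phi> b) * cnj (\<psi> j b) \<partial>M)"
      and int_cnj: "integrable M (\<lambda>b. cnj (\<phi> b) * cnj (\<psi> j b))" for j
      by (simp_all add: has_bochner_integral_iff)
    have "(\<integral>b. F a b \<partial>M) = (\<Sum>j\<in>J. \<phi> a * \<psi> j a * cnj (v j))" for a
    proof -
      have "(\<integral>b. F a b \<partial>M) = (\<integral>b. (\<Sum>j\<in>J. \<phi> a * \<psi> j a * (cnj (\<phi> b) * cnj (\<psi> j b))) \<partial>M)"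
        by (simp add: F_def K sum_distrib_left mult_ac)
      also have "\<dots> = (\<Sum>j\<in>J. \<phi> a * \<psi> j a * cnj (v j))"
        unfolding cv by (subst Bochner_Integration.integral_sum) (auto simp: int_cnj)
      finally show ?thesis .
    qed
    then have "(\<integral>a. (\<integral>b. F a b \<partial>M) \<partial>M) = (\<integral>a. (\<Sum>j\<in>J. \<phi> a * \<psi> j a * cnj (v j)) \<partial>M)"
      by simp
    also have "\<dots> = (\<Sum>j\<in>J. v j * cnj (v j))"
      by (subst Bochner_Integration.integral_sum) (auto simp: v_def)
    finally show ?thesis by simp
  qed
  also have "\<dots> = (\<integral>(a, b). F a b \<partial>(M \<Otimes>\<^sub>M M))"
    using MM.integral_fst[OF F_int] by simp
  finally have "I\<^sup>2 \<le> L * (\<integral>x. norm (case x of (a, b) \<Rightarrow> F a b) \<partial>(M \<Otimes>\<^sub>M M))"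
    by (rule order_trans) (intro mult_left_mono integral_norm_bound L0)
  also have "\<dots> = (\<integral>x. L * norm (case x of (a, b) \<Rightarrow> F a b) \<partial>(M \<Otimes>\<^sub>M M))"
    by simp
  also have "\<dots> \<le> (\<integral>(a, b). U a * U b / 4 + 2 powr p / 8 * (\<kappa> a b * (U a + U b)) \<partial>(M \<Otimes>\<^sub>M M))"
  proof (rule integral_mono)
    show "integrable (M \<Otimes>\<^sub>M M) (\<lambda>x. L * norm (case x of (a, b) \<Rightarrow> F a b))"
      using F_int by simp
    show "integrable (M \<Otimes>\<^sub>M M) (\<lambda>(a, b). U a * U b / 4 + 2 powr p / 8 * (\<kappa> a b * (U a + U b)))"
      using UU_int \<kappa>U_int by (simp add: split_beta' ring_distribs)
    fix x :: "'a \<times> 'a"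
    obtain a b where x: "x = (a, b)" by (cases x)
    show "L * norm (case x of (a, b) \<Rightarrow> F a b)
        \<le> (case x of (a, b) \<Rightarrow> U a * U b / 4 + 2 powr p / 8 * (\<kappa> a b * (U a + U b)))"
    proof (cases "a \<in> A \<and> b \<in> A")
      case True
      then show ?thesis
        using powr_large_values_dichotomy[OF p norm_ge_zero norm_ge_zero _ \<kappa>_bounds(1) dichotomy[of a b]]
        by (simp add: x F_def norm_mult norm_\<phi> U_def L_def mult_ac)
    next
      case False
      then have "F a b = 0" by (auto simp: F_def \<phi>_def)
      then show ?thesis using U0 \<kappa>_bounds(1) by (simp add: x)
    qed
  qed
  also have "\<dots> = I\<^sup>2 / 4 + 2 powr p / 8 *
      ((\<integral>(a, b). \<kappa> a b * U a \<partial>(M \<Otimes>\<^sub>M M)) + (\<integral>(a, b). \<kappa> a b * U b \<partial>(M \<Otimes>\<^sub>M M)))"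
  proof -
    have "(\<integral>(a, b). U a * U b \<partial>(M \<Otimes>\<^sub>M M)) = I\<^sup>2"
      using MM.integral_fst[OF UU_int, symmetric] by (simp add: I_def power2_eq_square)
    then show ?thesis
      using UU_int \<kappa>U_int by (simp add: split_beta' ring_distribs)
  qed
  also have "(\<integral>(a, b). \<kappa> a b * U a \<partial>(M \<Otimes>\<^sub>M M)) \<le> Q * I"
  proof -
    have "(\<integral>(a, b). \<kappa> a b * U a \<partial>(M \<Otimes>\<^sub>M M)) = (\<integral>a. (\<integral>b. \<kappa> a b \<partial>M) * U a \<partial>M)"
      using MM.integral_fst[OF \<kappa>U_int(1), symmetric] by simp
    also have "\<dots> \<le> (\<integral>a. Q * U a \<partial>M)"
      using MM.integrable_fst[OF \<kappa>U_int(1)] \<kappa>_integral(1) U0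
      by (intro integral_mono) (auto intro: mult_right_mono)
    finally show ?thesis by (simp add: I_def)
  qed
  also have "(\<integral>(a, b). \<kappa> a b * U b \<partial>(M \<Otimes>\<^sub>M M)) \<le> Q * I"
  proof -
    have "(\<integral>(a, b). \<kappa> a b * U b \<partial>(M \<Otimes>\<^sub>M M)) = (\<integral>b. (\<integral>a. \<kappa> a b \<partial>M) * U b \<partial>M)"
      using MM.integral_snd[OF \<kappa>U_int(2), symmetric] by simp
    also have "\<dots> \<le> (\<integral>b. Q * U b \<partial>M)"
      using MM.integrable_snd[OF \<kappa>U_int(2)] \<kappa>_integral(2) U0
      by (intro integral_mono) (auto intro: mult_right_mono)
    finally show ?thesis by (simp add: I_def)
  qed
  finally have "I * (3 * I) \<le> I * (2 powr p * Q)"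
    by (simp add: power2_eq_square algebra_simps)
  then have "3 * I \<le> 2 powr p * Q \<or> I = 0"
    using I0 mult_le_cancel_left_pos[of I "3 * I" "2 powr p * Q"] by linarith
  then have "I \<le> 2 powr p * Q"
    using Q I0 by auto
  then show ?thesis by (simp add: I_def U_def)
qed

section \<open>Integration over the circle\<close>

text \<open>
  The circle as a finite measure space, so that general facts about integrals and product measures
  apply to it directly.
\<close>

definition circle :: "real measure" where
  "circle = restrict_space lborel {0..<1}"

lemma space_circle: "space circle = {0..<1}"
  by (simp add: circle_def)

lemma circle_integral_eq: "circle_integral F = (\<integral>\<alpha>. F \<alpha> \<partial>circle)"
  unfolding circle_integral_def circle_def set_lebesgue_integral_def
  by (subst integral_restrict_space) auto

lemma finite_measure_circle: "finite_measure circle"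
  by (rule finite_measureI) (simp add: circle_def emeasure_restrict_space)

lemma measurable_circle [measurable (raw)]:
  "f \<in> borel_measurable borel \<Longrightarrow> f \<in> borel_measurable circle"
  unfolding circle_def by (intro measurable_restrict_space1) simp

lemma integrable_circle:
  fixes f :: "real \<Rightarrow> 'b::{banach, second_countable_topology}"
  assumes "f \<in> borel_measurable borel" "\<And>x. norm (f x) \<le> B"
  shows "integrable circle f"
proof -
  interpret finite_measure circle by (rule finite_measure_circle)
  show ?thesis
    using assms by (intro integrable_const_bound[of _ B]) auto
qed

lemma circle_integral_character:
  assumes "n \<noteq> 0"
  shows "(\<integral>\<alpha>. e (\<alpha> * real_of_int n) \<partial>circle) = 0"
proof -
  define F where "F \<alpha> = e (\<alpha> * real_of_int n) / (2 * of_real pi * \<i> * of_int n)" for \<alpha>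
  have "(F has_vector_derivative e (x * real_of_int n)) (at x within {0..1})" for x
    unfolding F_def e_def using assms
    by (auto intro!: derivative_eq_intros has_vector_derivative_real_field simp: field_simps)
  then have "has_bochner_integral lborel (\<lambda>x. indicator {0..1} x *\<^sub>R e (x * real_of_int n)) (F 1 - F 0)"
    by (intro has_bochner_integral_FTC_Icc) (auto intro!: continuous_intros)
  moreover have "F 1 - F 0 = 0"
    by (simp add: F_def)
  moreover have "AE x in lborel. indicator {0..<1} x *\<^sub>R e (x * real_of_int n)
      = indicator {0..1} x *\<^sub>R e (x * real_of_int n)"
    using AE_lborel_singleton[of "1::real"] by eventually_elim (auto simp: indicator_def)
  then have "(\<integral>x. indicator {0..<1} x *\<^sub>R e (x * real_of_int n) \<partial>lborel)
      = (\<integral>x. indicator {0..1} x *\<^sub>R e (x * real_of_int n) \<partial>lborel)"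
    by (intro integral_cong_AE) auto
  ultimately show ?thesis
    unfolding circle_def by (subst integral_restrict_space) (auto simp: has_bochner_integral_iff)
qed

text \<open>
  Distinct integer frequencies are orthonormal, so the integral is the sum of the \<open>\<bar>c j\<bar>\<^sup>2\<close>.
\<close>

lemma Parseval_le:
  fixes n :: "'i \<Rightarrow> int"
  assumes J: "finite J" and inj: "inj_on n J" and c: "\<And>j. norm (c j) \<le> 1"
  shows "(\<integral>\<alpha>. (norm (\<Sum>j\<in>J. c j * e (\<alpha> * real_of_int (n j))))\<^sup>2 \<partial>circle) \<le> real (card J)"
proof -
  have int: "integrable circle (\<lambda>\<alpha>. e (\<alpha> * real_of_int m))" for m
    by (rule integrable_circle[of _ 1]) auto
  have ortho: "(\<integral>\<alpha>. e (\<alpha> * real_of_int m) \<partial>circle) = (if m = 0 then 1 else 0)" for m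
    using circle_integral_character[of m]
    by (auto simp: circle_def measure_restrict_space)
  have "complex_of_real (\<integral>\<alpha>. (norm (\<Sum>j\<in>J. c j * e (\<alpha> * real_of_int (n j))))\<^sup>2 \<partial>circle)
      = (\<integral>\<alpha>. (\<Sum>j\<in>J. \<Sum>k\<in>J. c j * cnj (c k) * e (\<alpha> * real_of_int (n j - n k))) \<partial>circle)"
    by (simp add: integral_complex_of_real[symmetric] complex_norm_square sum_product cnj_sum cnj_e
        e_add[symmetric] mult_ac right_diff_distrib' del: of_real_power)
  also have "\<dots> = (\<Sum>j\<in>J. \<Sum>k\<in>J. c j * cnj (c k) * (if j = k then 1 else 0))"
    using int inj by (simp add: ortho inj_on_eq_iff cong: sum.cong del: of_int_diff)
  also have "\<dots> = of_real (\<Sum>j\<in>J. (norm (c j))\<^sup>2)"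
    using J by (simp add: complex_norm_square if_distrib[of "\<lambda>x. _ * x"] del: of_real_power cong: if_cong)
  finally have "(\<integral>\<alpha>. (norm (\<Sum>j\<in>J. c j * e (\<alpha> * real_of_int (n j))))\<^sup>2 \<partial>circle)
      = (\<Sum>j\<in>J. (norm (c j))\<^sup>2)"
    by (simp only: of_real_eq_iff)
  also have "\<dots> \<le> (\<Sum>j\<in>J. 1)"
    using c by (intro sum_mono) (simp add: power_le_one)
  finally show ?thesis by simp
qed

lemma nn_integral_tail_le:
  fixes \<Lambda> q :: real
  assumes "\<Lambda> > 0" "q > 1"
  shows "(\<integral>\<^sup>+t. ennreal ((1 + \<Lambda> * \<bar>t\<bar>) powr - q) \<partial>lborel) \<le> ennreal (2 / (\<Lambda> * (q - 1)))"
proof -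
  define f where "f t = (1 + \<Lambda> * t) powr - q" for t
  define F where "F t = - ((1 + \<Lambda> * t) powr (1 - q)) / (\<Lambda> * (q - 1))" for t
  have [measurable]: "f \<in> borel_measurable borel"
    unfolding f_def[abs_def] by measurable
  have pos: "1 + \<Lambda> * x > 0" if "x \<ge> 0" for x
    using assms that by (simp add: add_pos_nonneg)
  have half: "(\<integral>\<^sup>+t. ennreal (f t) * indicator {0..} t \<partial>lborel) = ennreal (0 - F 0)"
  proof (rule nn_integral_FTC_atLeast)
    fix x :: real assume "0 \<le> x"
    note p = pos[OF this]
    have "((\<lambda>t. (1 + \<Lambda> * t) powr (1 - q)) has_real_derivative
        (1 - q) * (1 + \<Lambda> * x) powr (1 - q - of_nat 1) * \<Lambda>) (at x)"
      using p by (intro DERIV_fun_powr) (auto intro!: derivative_eq_intros)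
    then have "(F has_real_derivative
        - ((1 - q) * (1 + \<Lambda> * x) powr (1 - q - of_nat 1) * \<Lambda>) / (\<Lambda> * (q - 1))) (at x)"
      unfolding F_def by (intro DERIV_cdivide DERIV_minus)
    moreover have "- ((1 - q) * (1 + \<Lambda> * x) powr (1 - q - of_nat 1) * \<Lambda>) / (\<Lambda> * (q - 1)) = f x"
      using assms by (simp add: f_def divide_simps) (simp add: algebra_simps)
    ultimately show "DERIV F x :> f x"
      by simp
    show "0 \<le> f x" by (simp add: f_def)
  next
    have "filterlim (\<lambda>t. 1 + \<Lambda> * t) at_top at_top"
      using assms by (intro filterlim_tendsto_add_at_top[OF tendsto_const]
          filterlim_tendsto_pos_mult_at_top[OF tendsto_const] filterlim_ident) auto
    then have "((\<lambda>t. (1 + \<Lambda> * t) powr (1 - q)) \<longlongrightarrow> 0) at_top"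
      using assms by (intro tendsto_neg_powr) auto
    then have "((\<lambda>t. - ((1 + \<Lambda> * t) powr (1 - q)) / (\<Lambda> * (q - 1))) \<longlongrightarrow> - 0 / (\<Lambda> * (q - 1))) at_top"
      using assms by (intro tendsto_intros) auto
    then show "(F \<longlongrightarrow> 0) at_top"
      unfolding F_def[abs_def] by simp
  qed auto
  have "(\<integral>\<^sup>+t. ennreal ((1 + \<Lambda> * \<bar>t\<bar>) powr - q) \<partial>lborel)
      \<le> (\<integral>\<^sup>+t. ennreal (f t) * indicator {0..} t + ennreal (f (- t)) * indicator {0..} (- t) \<partial>lborel)"
    by (intro nn_integral_mono) (auto simp: f_def indicator_def abs_if)
  also have "\<dots> = (\<integral>\<^sup>+t. ennreal (f t) * indicator {0..} t \<partial>lborel)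
      + (\<integral>\<^sup>+t. ennreal (f (- t)) * indicator {0..} (- t) \<partial>lborel)"
    by (intro nn_integral_add) auto
  also have "(\<integral>\<^sup>+t. ennreal (f (- t)) * indicator {0..} (- t) \<partial>lborel)
      = (\<integral>\<^sup>+t. ennreal (f t) * indicator {0..} t \<partial>lborel)"
    using nn_integral_real_affine[of "\<lambda>t. ennreal (f t) * indicator {0..} t" "-1" 0] by simp
  also have "(\<integral>\<^sup>+t. ennreal (f t) * indicator {0..} t \<partial>lborel)
      + (\<integral>\<^sup>+t. ennreal (f t) * indicator {0..} t \<partial>lborel) = ennreal (2 / (\<Lambda> * (q - 1)))"
    unfolding half using assms by (simp add: F_def ennreal_plus[symmetric] del: ennreal_plus)
  finally show ?thesis .
qed

text \<open>
  The bound does not depend on the translation \<open>d\<close>, as the integral is dominated by the one over the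
  whole line. The sign \<open>s\<close> covers both marginals of a kernel depending on \<open>\<alpha> - \<beta>\<close>.
\<close>

lemma circle_integral_tail_le:
  fixes \<Lambda> q d s :: real
  assumes "\<Lambda> > 0" "q > 1" and s: "s = 1 \<or> s = - 1"
  shows "(\<integral>t. (1 + \<Lambda> * \<bar>s * t + d\<bar>) powr - q \<partial>circle) \<le> 2 / (\<Lambda> * (q - 1))"
proof -
  have "(\<integral>\<^sup>+t. ennreal ((1 + \<Lambda> * \<bar>s * t + d\<bar>) powr - q) \<partial>circle)
      \<le> (\<integral>\<^sup>+t. ennreal ((1 + \<Lambda> * \<bar>s * t + d\<bar>) powr - q) \<partial>lborel)"
    unfolding circle_def
    by (subst nn_integral_restrict_space) (auto intro!: nn_integral_mono simp: indicator_def)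
  also have "\<dots> = (\<integral>\<^sup>+t. ennreal ((1 + \<Lambda> * \<bar>t\<bar>) powr - q) \<partial>lborel)"
    using nn_integral_real_affine[of "\<lambda>t. ennreal ((1 + \<Lambda> * \<bar>t\<bar>) powr - q)" s d] s
    by (auto simp: add.commute)
  also have "\<dots> \<le> ennreal (2 / (\<Lambda> * (q - 1)))"
    by (rule nn_integral_tail_le) (use assms in auto)
  finally have "(\<integral>\<^sup>+t. ennreal ((1 + \<Lambda> * \<bar>s * t + d\<bar>) powr - q) \<partial>circle)
      \<le> ennreal (2 / (\<Lambda> * (q - 1)))" .
  then show ?thesis
    using assms by (subst integral_eq_nn_integral) (auto intro!: enn2real_leI)
qed

section \<open>The moment estimate\<close>

text \<open>
  The exponent of \<open>W\<close> in \<open>R = W\<^sup>1\<^sup>/\<^sup>(\<^sup>p\<^sup>-\<^sup>2\<^sup>)\<close> is the one for which the small values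
  \<open>\<bar>h\<bar> < N\<^sup>2 / R\<close> contribute \<open>(N\<^sup>2 / R)\<^sup>p\<^sup>-\<^sup>2 N\<^sup>2 = N\<^sup>2\<^sup>p\<^sup>-\<^sup>2 / W\<close> by Parseval. For the large
  values, the kernel estimate gives the majorant
  \<open>(3 N\<^sup>4)\<^sup>p\<^sup>/\<^sup>2 (1 + W N\<^sup>2 \<bar>\<alpha> - \<beta>\<bar>)\<^sup>-\<^sup>p\<^sup>/\<^sup>2\<close> and its translates by \<open>1\<close> and \<open>-1\<close>, each of integral
  of order \<open>N\<^sup>2\<^sup>p / (W N\<^sup>2)\<close> because \<open>p / 2 > 1\<close>.
\<close>

lemma upper_half_moment_bound:
  fixes a :: int and N n W H :: nat and R p :: real and f g :: "nat \<Rightarrow> complex"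
  assumes N: "N > 0" "real N / 2 \<le> real_of_int a" "a + int n \<le> int N + 1"
    and W: "W > 0" and p: "p > 2" and R: "R \<ge> 1" "R powr (p - 2) = real W"
    and H: "576 * R ^ 4 \<le> real H" "16 * (real H)\<^sup>2 * R\<^sup>2 * real W \<le> real N"
    and f: "\<And>i. norm (f i) \<le> 1" and g: "\<And>i. norm (g i) \<le> 1"
  shows "circle_integral (\<lambda>\<alpha>. norm (
            (\<Sum>i<n. f i * e (real W * \<alpha> * (real_of_int (a + int i))\<^sup>2)) *
            (\<Sum>i<n. g i * e (\<alpha> * real_of_int (a + int i)))) powr p)
          \<le> (1 + 2 powr p * (12 * 3 powr (p / 2) / (p - 2))) * real N powr (2 * p - 2) * inverse (real W)"
proof -
  \<comment> \<open>The product of the two sums is one exponential sum over pairs, with frequencies \<open>\<nu>\<close>.\<close>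
  define J where "J = {..<n} \<times> {..<n}"
  define \<nu> where "\<nu> = (\<lambda>(i, k). int W * (a + int i)\<^sup>2 + (a + int k))"
  define c where "c = (\<lambda>(i, k). f i * g k)"
  define h where "h \<alpha> = (\<Sum>j\<in>J. c j * e (\<alpha> * real_of_int (\<nu> j)))" for \<alpha>
  define K where "K \<alpha> \<beta> = (\<Sum>j\<in>J. e (\<alpha> * real_of_int (\<nu> j)) * cnj (e (\<beta> * real_of_int (\<nu> j))))" for \<alpha> \<beta>
  define A where "A = {\<alpha> \<in> space circle. (real N)\<^sup>2 / R \<le> norm (h \<alpha>)}"
  define \<Lambda> where "\<Lambda> = real W * (real N)\<^sup>2"
  define q where "q = p / 2"
  define P where "P = (3 * (real N) ^ 4) powr q"
  define \<kappa> where "\<kappa> \<alpha> \<beta> = (\<Sum>s\<in>{-1, 0, 1}. P * (1 + \<Lambda> * \<bar>\<alpha> - \<beta> + s\<bar>) powr - q)" for \<alpha> \<beta>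
  define T where "T = 2 / (\<Lambda> * (q - 1))"
  interpret finite_measure circle by (rule finite_measure_circle)
  have q: "q > 1" using p by (simp add: q_def)
  have \<Lambda>: "\<Lambda> > 0" using W N by (simp add: \<Lambda>_def)
  have T0: "T \<ge> 0" using \<Lambda> q by (simp add: T_def)
  have P0: "P \<ge> 0" by (simp add: P_def)
  have "a \<ge> 1" using N by linarith
  then have nN: "n \<le> N" and na: "int n \<le> 2 * a" using N by linarith+
  have card: "real (card J) \<le> (real N)\<^sup>2"
    using nN by (simp add: J_def card_cartesian_product power2_eq_square mult_mono)
  have finJ: "finite J" by (simp add: J_def)
  have injJ: "inj_on \<nu> J"
    unfolding \<nu>_def J_def by (rule frequencies_inj[OF W na])
  have c: "norm (c j) \<le> 1" for j
    by (cases j) (auto simp: c_def norm_mult intro!: mult_le_one f g)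
  have factor: "(\<Sum>i<n. u i * e (real W * \<alpha> * (real_of_int (a + int i))\<^sup>2)) *
            (\<Sum>i<n. v i * e (\<alpha> * real_of_int (a + int i)))
      = (\<Sum>(i, k)\<in>J. u i * v k * e (\<alpha> * real_of_int (\<nu> (i, k))))" for \<alpha> u v
  proof -
    have "e (real W * \<alpha> * (real_of_int (a + int i))\<^sup>2) * e (\<alpha> * real_of_int (a + int k))
        = e (\<alpha> * real_of_int (\<nu> (i, k)))" for i k
      unfolding e_add[symmetric] by (rule arg_cong[where f = e]) (simp add: \<nu>_def algebra_simps)
    then have term_eq: "u i * e (real W * \<alpha> * (real_of_int (a + int i))\<^sup>2) * (v k * e (\<alpha> * real_of_int (a + int k)))
        = u i * v k * e (\<alpha> * real_of_int (\<nu> (i, k)))" for i k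
      by (metis mult.assoc mult.left_commute)
    then show ?thesis
      unfolding sum_product sum.cartesian_product J_def by (simp only: term_eq)
  qed
  have h_eq: "h \<alpha> = (\<Sum>i<n. f i * e (real W * \<alpha> * (real_of_int (a + int i))\<^sup>2)) *
            (\<Sum>i<n. g i * e (\<alpha> * real_of_int (a + int i)))" for \<alpha>
    unfolding factor h_def c_def by (simp add: split_beta')
  have K_eq: "K \<alpha> \<beta> = (\<Sum>i<n. e (real W * (\<alpha> - \<beta>) * (real_of_int (a + int i))\<^sup>2)) *
            (\<Sum>i<n. e ((\<alpha> - \<beta>) * real_of_int (a + int i)))" for \<alpha> \<beta>
    using factor[of "\<lambda>_. 1" "\<alpha> - \<beta>" "\<lambda>_. 1"]
    by (simp add: K_def cnj_e e_add[symmetric] split_beta' left_diff_distrib)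
  have h_meas [measurable]: "h \<in> borel_measurable borel"
    unfolding h_def[abs_def] by measurable
  have h_le: "norm (h \<alpha>) \<le> (real N)\<^sup>2" for \<alpha>
  proof -
    have "norm (h \<alpha>) \<le> (\<Sum>j\<in>J. 1)"
      unfolding h_def using c by (intro sum_norm_le) (simp add: norm_mult)
    also have "\<dots> \<le> (real N)\<^sup>2" using card by (simp del: of_nat_power)
    finally show ?thesis .
  qed
  have A_meas: "A \<in> sets circle"
    unfolding A_def by measurable
  have large: "(\<integral>\<alpha>. indicator A \<alpha> * norm (h \<alpha>) powr p \<partial>circle) \<le> 2 powr p * (3 * (P * T))"
  proof (rule large_values_moment_bound[OF finite_measure_circle finJ p _ _ c h_def K_def A_meas, where \<kappa> = \<kappa> and B = "3 * P"])
    show "(\<lambda>\<alpha>. e (\<alpha> * real_of_int (\<nu> j))) \<in> borel_measurable circle" for j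
      by measurable
    show "norm (e (\<alpha> * real_of_int (\<nu> j))) \<le> 1" for j \<alpha> by simp
    have [measurable]: "id \<in> borel_measurable circle"
      by (rule measurable_circle) simp
    have "(\<lambda>x. id (fst x)) \<in> borel_measurable (circle \<Otimes>\<^sub>M circle)"
      "(\<lambda>x. id (snd x)) \<in> borel_measurable (circle \<Otimes>\<^sub>M circle)"
      by (rule measurable_compose[OF measurable_fst] measurable_compose[OF measurable_snd], measurable)+
    then have "fst \<in> borel_measurable (circle \<Otimes>\<^sub>M circle)" "snd \<in> borel_measurable (circle \<Otimes>\<^sub>M circle)"
      by simp_all
    note [measurable] = this
    show "(\<lambda>(\<alpha>, \<beta>). \<kappa> \<alpha> \<beta>) \<in> borel_measurable (circle \<Otimes>\<^sub>M circle)"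
      unfolding \<kappa>_def split_beta' by measurable
    show "0 \<le> \<kappa> \<alpha> \<beta>" for \<alpha> \<beta>
      using P0 by (simp add: \<kappa>_def)
    have term_le: "(1 + \<Lambda> * \<bar>x\<bar>) powr - q \<le> 1" for x
      using \<Lambda> q powr_mono[of "-q" 0 "1 + \<Lambda> * \<bar>x\<bar>"] by (simp split: if_splits)
    have "\<kappa> \<alpha> \<beta> \<le> (\<Sum>s\<in>{-1, 0, 1::real}. P * 1)" for \<alpha> \<beta>
      unfolding \<kappa>_def using P0 term_le by (intro sum_mono mult_left_mono) auto
    then show "\<kappa> \<alpha> \<beta> \<le> 3 * P" for \<alpha> \<beta>
      by simp
    have int: "integrable circle (\<lambda>x. (1 + \<Lambda> * \<bar>s * x + d\<bar>) powr - q)" for s d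
      using term_le by (intro integrable_circle[of _ 1]) auto
    have int_le: "(\<integral>x. (\<Sum>s\<in>{-1, 0, 1}. P * (1 + \<Lambda> * \<bar>\<sigma> * x + d s\<bar>) powr - q) \<partial>circle) \<le> 3 * (P * T)"
      if "\<sigma> = 1 \<or> \<sigma> = -1" for \<sigma> :: real and d :: "real \<Rightarrow> real"
    proof -
      have "(\<integral>x. (\<Sum>s\<in>{-1, 0, 1}. P * (1 + \<Lambda> * \<bar>\<sigma> * x + d s\<bar>) powr - q) \<partial>circle)
          = (\<Sum>s\<in>{-1, 0, 1}. P * (\<integral>x. (1 + \<Lambda> * \<bar>\<sigma> * x + d s\<bar>) powr - q \<partial>circle))"
        using int by (subst Bochner_Integration.integral_sum) auto
      also have "\<dots> \<le> (\<Sum>s\<in>{-1, 0, 1::real}. P * T)"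
        unfolding T_def by (intro sum_mono mult_left_mono circle_integral_tail_le \<Lambda> q that P0)
      finally show ?thesis by simp
    qed
    show "(\<integral>\<beta>. \<kappa> \<alpha> \<beta> \<partial>circle) \<le> 3 * (P * T)" for \<alpha>
      using int_le[of "-1" "\<lambda>s. \<alpha> + s"] unfolding \<kappa>_def by (simp add: algebra_simps)
    show "(\<integral>\<alpha>. \<kappa> \<alpha> \<beta> \<partial>circle) \<le> 3 * (P * T)" for \<beta>
      using int_le[of 1 "\<lambda>s. s - \<beta>"] unfolding \<kappa>_def by (simp add: algebra_simps)
    show "0 \<le> 3 * (P * T)" using P0 T0 by simp
  next
    fix \<alpha> \<beta> assume "\<alpha> \<in> A" "\<beta> \<in> A"
    then have *: "\<bar>\<alpha> - \<beta>\<bar> < 1" "(real N)\<^sup>2 / R \<le> norm (h \<alpha>)" "(real N)\<^sup>2 / R \<le> norm (h \<beta>)"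
      by (auto simp: A_def space_circle)
    have m_le: "real (card J) * norm (K \<alpha> \<beta>) \<le> (real N)\<^sup>2 * norm (K \<alpha> \<beta>)"
      using card by (intro mult_right_mono) auto
    have "norm (K \<alpha> \<beta>) \<le> (real N)\<^sup>2 / (4 * R\<^sup>2) \<or> (\<exists>s\<in>{-1, 0, 1}.
        norm (K \<alpha> \<beta>) \<le> 3 * (real N)\<^sup>2 / (1 + real W * (real N)\<^sup>2 * \<bar>\<alpha> - \<beta> + s\<bar>))"
      using kernel_bound[OF N W R(1) H *(1)] by (simp only: K_eq norm_mult)
    then show "real (card J) * norm (K \<alpha> \<beta>) \<le> norm (h \<alpha>) * norm (h \<beta>) / 4 \<or>
        (real (card J) * norm (K \<alpha> \<beta>)) powr (p / 2) \<le> \<kappa> \<alpha> \<beta>"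
    proof (elim disjE bexE)
      assume "norm (K \<alpha> \<beta>) \<le> (real N)\<^sup>2 / (4 * R\<^sup>2)"
      then have "(real N)\<^sup>2 * norm (K \<alpha> \<beta>) \<le> (real N)\<^sup>2 * ((real N)\<^sup>2 / (4 * R\<^sup>2))"
        by (intro mult_left_mono) auto
      also have "\<dots> = ((real N)\<^sup>2 / R) * ((real N)\<^sup>2 / R) / 4"
        by (simp add: power2_eq_square)
      also have "\<dots> \<le> norm (h \<alpha>) * norm (h \<beta>) / 4"
        using * R by (intro divide_right_mono mult_mono) auto
      finally show ?thesis using m_le by linarith
    next
      fix s :: real
      assume s: "s \<in> {-1, 0, 1}"
        and b: "norm (K \<alpha> \<beta>) \<le> 3 * (real N)\<^sup>2 / (1 + real W * (real N)\<^sup>2 * \<bar>\<alpha> - \<beta> + s\<bar>)"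
      define y where "y = 1 + \<Lambda> * \<bar>\<alpha> - \<beta> + s\<bar>"
      have "real (card J) * norm (K \<alpha> \<beta>) \<le> (real N)\<^sup>2 * (3 * (real N)\<^sup>2 / y)"
        unfolding y_def \<Lambda>_def by (rule order_trans[OF m_le mult_left_mono[OF b]]) simp
      also have "\<dots> = 3 * real N ^ 4 / y"
        by (simp add: power2_eq_square power4_eq_xxxx)
      finally have "(real (card J) * norm (K \<alpha> \<beta>)) powr q \<le> (3 * real N ^ 4 / y) powr q"
        using q by (intro powr_mono2) auto
      also have "\<dots> = P * y powr - q"
        unfolding P_def powr_minus divide_inverse[symmetric] by (rule powr_divide)
      also have "\<dots> \<le> \<kappa> \<alpha> \<beta>"
        unfolding \<kappa>_def y_def
        by (rule member_le_sum[OF s, of "\<lambda>s. P * (1 + \<Lambda> * \<bar>\<alpha> - \<beta> + s\<bar>) powr - q"]) (use P0 in auto)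
      finally show ?thesis by (simp add: q_def)
    qed
  qed
  have powr_le: "norm (h \<alpha>) powr p \<le> ((real N)\<^sup>2) powr p" for \<alpha>
    using h_le p by (intro powr_mono2) auto
  have int_p: "integrable circle (\<lambda>\<alpha>. norm (h \<alpha>) powr p)"
    using powr_le by (intro integrable_circle[of _ "((real N)\<^sup>2) powr p"]) auto
  have int_A: "integrable circle (\<lambda>\<alpha>. indicator A \<alpha> * norm (h \<alpha>) powr p)"
    using integrable_real_mult_indicator[OF A_meas int_p] by (simp add: mult.commute)
  have int_2: "integrable circle (\<lambda>\<alpha>. (norm (h \<alpha>))\<^sup>2)"
  proof (rule integrable_circle)
    show "norm ((norm (h \<alpha>))\<^sup>2) \<le> ((real N)\<^sup>2)\<^sup>2" for \<alpha>
      using power_mono[OF h_le norm_ge_zero, of \<alpha> 2] by simp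
  qed measurable
  have "(\<integral>\<alpha>. norm (h \<alpha>) powr p \<partial>circle)
      \<le> (\<integral>\<alpha>. indicator A \<alpha> * norm (h \<alpha>) powr p + ((real N)\<^sup>2 / R) powr (p - 2) * (norm (h \<alpha>))\<^sup>2 \<partial>circle)"
  proof (rule integral_mono)
    show "integrable circle (\<lambda>\<alpha>. indicator A \<alpha> * norm (h \<alpha>) powr p
        + ((real N)\<^sup>2 / R) powr (p - 2) * (norm (h \<alpha>))\<^sup>2)"
      using int_A int_2 by simp
    fix \<alpha> assume "\<alpha> \<in> space circle"
    show "norm (h \<alpha>) powr p \<le> indicator A \<alpha> * norm (h \<alpha>) powr p
        + ((real N)\<^sup>2 / R) powr (p - 2) * (norm (h \<alpha>))\<^sup>2"
    proof (cases "\<alpha> \<in> A")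
      case False
      then have "norm (h \<alpha>) \<le> (real N)\<^sup>2 / R"
        using \<open>\<alpha> \<in> space circle\<close> by (simp add: A_def)
      then have "norm (h \<alpha>) powr (p - 2) \<le> ((real N)\<^sup>2 / R) powr (p - 2)"
        using p by (intro powr_mono2) auto
      moreover have "norm (h \<alpha>) powr p = norm (h \<alpha>) powr (p - 2) * (norm (h \<alpha>))\<^sup>2"
        using powr_add[of "norm (h \<alpha>)" "p - 2" 2] by (cases "h \<alpha> = 0") (auto simp: powr_numeral)
      ultimately show ?thesis
        using False by (simp add: mult_right_mono)
    qed simp
  qed (rule int_p)
  also have "\<dots> = (\<integral>\<alpha>. indicator A \<alpha> * norm (h \<alpha>) powr p \<partial>circle)
      + ((real N)\<^sup>2 / R) powr (p - 2) * (\<integral>\<alpha>. (norm (h \<alpha>))\<^sup>2 \<partial>circle)"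
    using int_A int_2 by simp
  also have "\<dots> \<le> 2 powr p * (3 * (P * T)) + ((real N)\<^sup>2 / R) powr (p - 2) * (real N)\<^sup>2"
    using large order_trans[OF Parseval_le[OF finJ injJ c] card]
    by (intro add_mono mult_left_mono) (auto simp: h_def)
  also have "\<dots> = (1 + 2 powr p * (12 * 3 powr (p / 2) / (p - 2))) * real N powr (2 * p - 2) * inverse (real W)"
  proof -
    define X where "X = real N powr (2 * p - 2)"
    have N': "real N > 0" using N by simp
    have powr_pow: "(real N ^ k) powr s = real N powr (real k * s)" for k s
      by (simp only: powr_realpow[OF N', symmetric] powr_powr)
    have shift: "real N powr s * (real N)\<^sup>2 = real N powr (s + 2)" for s
      using N' by (simp add: powr_add)
    have "((real N)\<^sup>2 / R) powr (p - 2) = real N powr (2 * (p - 2)) / real W"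
      using powr_pow[of 2 "p - 2"] by (simp add: powr_divide R(2))
    then have "((real N)\<^sup>2 / R) powr (p - 2) * (real N)\<^sup>2 = X / real W"
      using shift[of "2 * (p - 2)"] by (simp add: X_def algebra_simps)
    moreover have "P = 3 powr (p / 2) * (X * (real N)\<^sup>2)"
      using powr_pow[of 4 "p / 2"] shift[of "2 * p - 2"] by (simp add: X_def P_def q_def powr_mult)
    moreover have "T = 4 / (real W * (real N)\<^sup>2 * (p - 2))"
      using p N W by (simp add: T_def \<Lambda>_def q_def field_simps)
    ultimately have "2 powr p * (3 * (P * T)) + ((real N)\<^sup>2 / R) powr (p - 2) * (real N)\<^sup>2
        = 2 powr p * (3 * (3 powr (p / 2) * (X * (real N)\<^sup>2) * (4 / (real W * (real N)\<^sup>2 * (p - 2)))))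
          + X / real W"
      by simp
    also have "\<dots> = (1 + 2 powr p * (12 * 3 powr (p / 2) / (p - 2))) * X * inverse (real W)"
      using p N' W by (simp add: field_simps)
    finally show ?thesis by (simp only: X_def)
  qed
  finally show ?thesis
    by (simp add: circle_integral_eq h_eq)
qed

lemma sum_upper_half:
  fixes F :: "int \<Rightarrow> complex" and N :: nat
  shows "(\<Sum>x | real N / 2 < real_of_int x \<and> x \<le> int N. F x)
    = (\<Sum>i<N - N div 2. F (int (N div 2) + 1 + int i))"
proof -
  have "{x. real N / 2 < real_of_int x \<and> x \<le> int N} = (\<lambda>i. int (N div 2) + 1 + int i) ` {..<N - N div 2}"
  proof (intro equalityI subsetI)
    fix x assume "x \<in> {x. real N / 2 < real_of_int x \<and> x \<le> int N}"
    then have "int N < 2 * x" "x \<le> int N" by auto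
    then have "int (N div 2) < x" by linarith
    then have x: "x = int (N div 2) + 1 + int (nat (x - int (N div 2) - 1))" by simp
    have "nat (x - int (N div 2) - 1) < N - N div 2"
      using x \<open>x \<le> int N\<close> by linarith
    then show "x \<in> (\<lambda>i. int (N div 2) + 1 + int i) ` {..<N - N div 2}"
      using x by blast
  next
    fix x assume "x \<in> (\<lambda>i. int (N div 2) + 1 + int i) ` {..<N - N div 2}"
    then have "int N < 2 * x" "x \<le> int N" by auto
    then show "x \<in> {x. real N / 2 < real_of_int x \<and> x \<le> int N}" by auto
  qed
  moreover have "inj_on (\<lambda>i. int (N div 2) + 1 + int i) {..<N - N div 2}"
    by (rule inj_onI) simp
  ultimately show ?thesis
    by (simp add: sum.reindex)
qed

theorem theorem1p14:
  shows "\<forall>p::real. p > 2 \<longrightarrow> (\<exists>C::real. C > 0 \<and>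
    (\<forall>(W::nat) (N::nat). W > 0 \<longrightarrow> N > 0 \<longrightarrow>
      real N \<le> C * real W powr C \<or>
      (\<forall>(f :: int \<Rightarrow> complex) (g :: int \<Rightarrow> complex).
        (\<forall>x. norm (f x) \<le> indicator {1..int N} x) \<longrightarrow>
        (\<forall>y. norm (g y) \<le> indicator {1..int N} y) \<longrightarrow>
        circle_integral (\<lambda>\<alpha>. norm (
            (\<Sum>x | real N / 2 < real_of_int x \<and> x \<le> int N.
               f x * e (real W * \<alpha> * (real_of_int x)\<^sup>2)) *
            (\<Sum>y | real N / 2 < real_of_int y \<and> y \<le> int N.
               g y * e (\<alpha> * real_of_int y))) powr p)
          \<le> C * real N powr (2 * p - 2) * inverse (real W))))"
proof (intro allI impI)
  fix p :: real assume p: "p > 2"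
  define C0 where "C0 = 1 + 2 powr p * (12 * 3 powr (p / 2) / (p - 2))"
  \<comment> \<open>\<open>5326864 = 16 * 577\<^sup>2\<close> and \<open>10 / (p - 2)\<close> come from \<open>16 H\<^sup>2 R\<^sup>2 W \<le> 16 * 577\<^sup>2 R\<^sup>1\<^sup>0 W\<close> below.\<close>
  define C where "C = 5326864 + 10 / (p - 2) + C0"
  have C0: "C0 \<ge> 1" using p by (simp add: C0_def)
  have C: "C \<ge> C0" "C \<ge> 5326864" "C \<ge> 1 + 10 / (p - 2)" "C > 0"
    using p C0 by (simp_all add: C_def add_pos_pos add_nonneg_pos)
  show "\<exists>C::real. C > 0 \<and>
    (\<forall>(W::nat) (N::nat). W > 0 \<longrightarrow> N > 0 \<longrightarrow>
      real N \<le> C * real W powr C \<or>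
      (\<forall>(f :: int \<Rightarrow> complex) (g :: int \<Rightarrow> complex).
        (\<forall>x. norm (f x) \<le> indicator {1..int N} x) \<longrightarrow>
        (\<forall>y. norm (g y) \<le> indicator {1..int N} y) \<longrightarrow>
        circle_integral (\<lambda>\<alpha>. norm (
            (\<Sum>x | real N / 2 < real_of_int x \<and> x \<le> int N.
               f x * e (real W * \<alpha> * (real_of_int x)\<^sup>2)) *
            (\<Sum>y | real N / 2 < real_of_int y \<and> y \<le> int N.
               g y * e (\<alpha> * real_of_int y))) powr p)
          \<le> C * real N powr (2 * p - 2) * inverse (real W)))"
  proof (unfold disj_imp, intro exI[of _ C] conjI allI impI C(4))
    fix W N :: nat and f g :: "int \<Rightarrow> complex"
    assume W: "W > 0" and N: "N > 0" and large: "\<not> real N \<le> C * real W powr C"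
      and f: "\<forall>x. norm (f x) \<le> indicator {1..int N} x"
      and g: "\<forall>y. norm (g y) \<le> indicator {1..int N} y"
    define R where "R = real W powr (1 / (p - 2))"
    define H where "H = nat \<lceil>576 * R ^ 4\<rceil>"
    define a where "a = int (N div 2) + 1"
    define n where "n = N - N div 2"
    have R: "R \<ge> 1" "R powr (p - 2) = real W"
      using W p by (simp_all add: R_def ge_one_powr_ge_zero powr_powr)
    have R4: "R ^ 4 \<ge> 1" using R(1) by simp
    have H: "576 * R ^ 4 \<le> real H" "real H \<le> 577 * R ^ 4"
      using R4 unfolding H_def by linarith+
    have "16 * (real H)\<^sup>2 * R\<^sup>2 * real W \<le> 16 * (577 * R ^ 4)\<^sup>2 * R\<^sup>2 * real W"
      using H(2) by (intro mult_right_mono mult_left_mono power_mono) auto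
    also have "\<dots> = 5326864 * (R ^ 10 * real W)"
      by (simp add: power_mult_distrib flip: power_mult power_add)
    also have "R ^ 10 * real W = real W powr (1 + 10 / (p - 2))"
      using W by (simp add: R_def powr_add powr_powr flip: powr_realpow)
    also have "5326864 * real W powr (1 + 10 / (p - 2)) \<le> C * real W powr C"
      using C W by (intro mult_mono powr_mono) auto
    also have "\<dots> \<le> real N" using large by simp
    finally have H2: "16 * (real H)\<^sup>2 * R\<^sup>2 * real W \<le> real N" .
    have bounded: "norm (f x) \<le> 1" "norm (g x) \<le> 1" for x
      using order_trans[OF f[rule_format, of x]] order_trans[OF g[rule_format, of x]] by simp_all
    have "circle_integral (\<lambda>\<alpha>. norm (
            (\<Sum>x | real N / 2 < real_of_int x \<and> x \<le> int N.
               f x * e (real W * \<alpha> * (real_of_int x)\<^sup>2)) *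
            (\<Sum>y | real N / 2 < real_of_int y \<and> y \<le> int N.
               g y * e (\<alpha> * real_of_int y))) powr p)
        \<le> C0 * real N powr (2 * p - 2) * inverse (real W)"
      unfolding sum_upper_half a_def[symmetric] n_def[symmetric] C0_def
      by (rule upper_half_moment_bound[OF N _ _ W p R H(1) H2])
         (use N in \<open>auto simp: bounded a_def n_def\<close>)
    also have "\<dots> \<le> C * real N powr (2 * p - 2) * inverse (real W)"
      using C by (intro mult_right_mono) auto
    finally show "circle_integral (\<lambda>\<alpha>. norm (
            (\<Sum>x | real N / 2 < real_of_int x \<and> x \<le> int N.
               f x * e (real W * \<alpha> * (real_of_int x)\<^sup>2)) *
            (\<Sum>y | real N / 2 < real_of_int y \<and> y \<le> int N.
               g y * e (\<alpha> * real_of_int y))) powr p)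
          \<le> C * real N powr (2 * p - 2) * inverse (real W)" .
  qed
qed

end
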